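(* Let $\gamma_1,\gamma_3,\gamma_5,\dots$ be independent random variables with $\gamma_r\sim\operatorname{Gamma}(r,1)$. Then, for every integer $n\ge1$, $$\prod_{j=2}^{n}\gamma_{2j-1}\ \le_{\mathrm{Lt}}\ \lVert C_n\rVert^2,$$ where the empty product for $n=1$ equals $1$. Consequently, for every $n\ge 1$, $$\prod_{j=1}^{n}\gamma_{2j-1}\ \le_{\mathrm{Lt}}\ |H_n|^2 .$$
   Context: For nonnegative random variables $U,V$, write $U\le_{\mathrm{Lt}}V$ if $\mathbb{E}e^{-sU}\ge \mathbb{E}e^{-sV}$ for all $s\ge0$. $\operatorname{Gamma}(r,1)$ is the law with density $x^{r-1}e^{-x}/\Gamma(r)$ on $(0,\infty)$. For a symmetric $2k\times 2k$ complex matrix $A=(a_{ij})$, $\operatorname{haf}(A)=\sum_{M}\prod_{\{i,j\}\in M}a_{ij}$, summed over all perfect matchings $M$ of the index set; the hafnian of the empty matrix is $1$; the diagonal is irrelevant. $\mathcal{CN}(0,1)$ is the standard circular complex Gaussian law (independent centered real Gaussian real and imaginary parts of variance $1/2$). $G_{2n}$ is a $2n\times2n$ complex symmetric random matrix with independent $\mathcal{CN}(0,1)$ entries above the diagonal, and $H_n=\operatorname{haf}(G_{2n})$. $B_{2n-1}$ is a $(2n-1)\times(2n-1)$ complex symmetric random matrix with independent $\mathcal{CN}(0,1)$ entries above the diagonal, and $C_n\in\mathbb{C}^{2n-1}$ is its hafnian cofactor vector, $(C_n)_j=\operatorname{haf}((B_{2n-1})_{-j})$, $1\le j\le 2n-1$,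 where $(\cdot)_{-j}$ means deleting row and column $j$ (so $C_1=(1)$). $\lVert\cdot\rVert$ is the Euclidean norm. *)

theory Defs
  imports "HOL-Probability.Probability"
begin

text \<open>
  Matrices of varying size are functions \<open>nat \<Rightarrow> nat \<Rightarrow> complex\<close> considered on a finite index set
  (\<open>{1..m}\<close> for an \<open>m \<times> m\<close> matrix). Deleting row and column \<open>j\<close> removes \<open>j\<close> from the index set.
\<close>

definition perfect_matchings :: "'a set \<Rightarrow> 'a set set set" where
  "perfect_matchings V = {M. partition_on V M \<and> (\<forall>e\<in>M. card e = 2)}"

text \<open>
  The entry belonging to an edge \<open>{i, j}\<close> is read off above the diagonal; for a symmetric matrix
  the choice of orientation does not matter, see \<open>edge_entry_symmetric\<close>.
\<close>

definition hafnian :: "nat set \<Rightarrow> (nat \<Rightarrow> nat \<Rightarrow> complex) \<Rightarrow> complex" where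
  "hafnian V A = (\<Sum>M\<in>perfect_matchings V. \<Prod>e\<in>M. A (Min e) (Max e))"

lemma hafnian_empty [simp]: "hafnian {} A = 1"
proof -
  have "perfect_matchings ({} :: nat set) = {{}}"
    by (auto simp: perfect_matchings_def partition_on_def)
  then show ?thesis
    by (simp add: hafnian_def)
qed

lemma edge_entry_symmetric:
  fixes A :: "nat \<Rightarrow> nat \<Rightarrow> complex"
  assumes "A i j = A j i"
  shows "A (Min {i, j}) (Max {i, j}) = A i j"
  using assms by (cases "i \<le> j") (auto simp: min_def max_def)

definition hafnian_cofactor :: "nat set \<Rightarrow> (nat \<Rightarrow> nat \<Rightarrow> complex) \<Rightarrow> nat \<Rightarrow> complex" where
  "hafnian_cofactor V B j = hafnian (V - {j}) B"

text \<open>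
  The normal densities are parametrised by the standard deviation, so variance \<open>1/2\<close> is
  \<open>sqrt (1/2)\<close>.
\<close>

definition standard_complex_gaussian :: "'w measure \<Rightarrow> ('w \<Rightarrow> complex) \<Rightarrow> bool" where
  "standard_complex_gaussian N Z \<longleftrightarrow>
     prob_space.indep_var N borel (\<lambda>\<omega>. Re (Z \<omega>)) borel (\<lambda>\<omega>. Im (Z \<omega>)) \<and>
     distributed N lborel (\<lambda>\<omega>. Re (Z \<omega>)) (normal_density 0 (sqrt (1 / 2))) \<and>
     distributed N lborel (\<lambda>\<omega>. Im (Z \<omega>)) (normal_density 0 (sqrt (1 / 2)))"

text \<open>Nothing is assumed about the diagonal entries.\<close>

definition gaussian_symmetric_matrix ::
  "'w measure \<Rightarrow> nat \<Rightarrow> ('w \<Rightarrow> nat \<Rightarrow> nat \<Rightarrow> complex) \<Rightarrow> bool" where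
  "gaussian_symmetric_matrix N m G \<longleftrightarrow>
     prob_space N \<and>
     (\<forall>\<omega>\<in>space N. \<forall>i\<in>{1..m}. \<forall>j\<in>{1..m}. G \<omega> i j = G \<omega> j i) \<and>
     prob_space.indep_vars N (\<lambda>_. borel) (\<lambda>(i, j) \<omega>. G \<omega> i j) {(i, j). 1 \<le> i \<and> i < j \<and> j \<le> m} \<and>
     (\<forall>i j. 1 \<le> i \<and> i < j \<and> j \<le> m \<longrightarrow> standard_complex_gaussian N (\<lambda>\<omega>. G \<omega> i j))"

definition gamma_density :: "real \<Rightarrow> real \<Rightarrow> real" where
  "gamma_density r x = (if 0 < x then x powr (r - 1) * exp (- x) / Gamma r else 0)"

text \<open>
  Intended for (almost surely) nonnegative random variables on probability spaces; the two
  variables may live on different spaces, as the order only depends on their laws.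
\<close>

definition laplace_le ::
  "'a measure \<Rightarrow> ('a \<Rightarrow> real) \<Rightarrow> 'b measure \<Rightarrow> ('b \<Rightarrow> real) \<Rightarrow> bool" where
  "laplace_le M U N V \<longleftrightarrow>
     (\<forall>s\<ge>0. (\<integral>\<omega>. exp (- s * U \<omega>) \<partial>M) \<ge> (\<integral>\<omega>. exp (- s * V \<omega>) \<partial>N))"

end

theory Submission
  imports Defs
begin

text \<open>
  Write \<open>\<Lambda>\<^sub>W(t)\<close> for the Laplace transform of the squared norm of the hafnian cofactor vector of a
  Gaussian matrix on an odd vertex set \<open>W\<close>. Pairing the cofactor vector with an independent
  Gaussian row \<open>u\<close> turns \<open>\<Lambda>\<^sub>W\<close> into the average over \<open>u\<close> of the characteristic function
  \<open>\<phi>(u) = E exp (i Re (\<Sum>\<^sub>j u\<^sub>j haf (W - {j})))\<close>. The point is that, for fixed Euclidean norm of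
  \<open>u\<close>, the modulus \<open>\<bar>\<phi>(u)\<bar>\<close> is largest when \<open>u\<close> is concentrated on one coordinate. It suffices to
  merge two coordinates \<open>u\<^sub>k, u\<^sub>l\<close>. With \<open>y, z\<close> the rows of the vertices \<open>k, l\<close> and everything
  else fixed, the exponent is, up to an independent phase,
  \<open>u\<^sub>k L(z) + u\<^sub>l L(y) + Q(y, z)\<close> with \<open>L\<close> linear and \<open>Q\<close> symmetric bilinear. Rotating two independent
  copies shows that the modulus of the Gaussian integral of this depends only on
  \<open>\<bar>u\<^sub>k\<bar>\<^sup>2 + \<bar>u\<^sub>l\<bar>\<^sup>2\<close>, and at \<open>u\<^sub>l = 0\<close> the integral is nonnegative, so that no cancellation occurs
  in the remaining average.

  For \<open>u\<close> concentrated at \<open>k\<close>, expanding along a further vertex \<open>l\<close> gives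
  \<open>\<Lambda>\<^sub>V(\<parallel>u\<parallel>\<^sup>2 / 4)\<close> with \<open>V = W - {k, l}\<close>; as \<open>\<parallel>u\<parallel>\<^sup>2\<close> is Gamma distributed with parameter
  \<open>card W\<close>, the first claim follows by induction. The second one follows because, given the
  cofactor vector \<open>C\<close>, \<open>\<bar>H\<bar>\<^sup>2\<close> is \<open>\<parallel>C\<parallel>\<^sup>2\<close> times an independent exponential variable.
\<close>

section \<open>Rotation invariance of the complex Gaussian law\<close>

definition real_gauss :: "real measure" where
  "real_gauss = density lborel (normal_density 0 (sqrt (1 / 2)))"

text \<open>The law CN(0,1) as a measure of its own, so that a family of independent Gaussian
  weights is a product measure \<open>PiM\<close>.\<close>

definition cgauss :: "complex measure" where
  "cgauss = distr (real_gauss \<Otimes>\<^sub>M real_gauss) borel (\<lambda>(x, y). Complex x y)"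

lemma borel_measurable_Complex [measurable (raw)]:
  assumes [measurable]: "f \<in> borel_measurable M" "g \<in> borel_measurable M"
  shows "(\<lambda>x. Complex (f x) (g x)) \<in> borel_measurable M"
  unfolding Complex_eq by measurable

lemma sets_real_gauss [simp, measurable_cong]: "sets real_gauss = sets borel"
  by (simp add: real_gauss_def)

lemma space_real_gauss [simp]: "space real_gauss = UNIV"
  by (simp add: real_gauss_def)

lemma sets_cgauss [simp, measurable_cong]: "sets cgauss = sets borel"
  by (simp add: cgauss_def)

lemma space_cgauss [simp]: "space cgauss = UNIV"
  by (simp add: cgauss_def)

lemma prob_space_real_gauss: "prob_space real_gauss"
  unfolding real_gauss_def by (rule prob_space_normal_density) auto

interpretation real_gauss: prob_space real_gauss
  by (rule prob_space_real_gauss)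

interpretation real_gauss2: pair_prob_space real_gauss real_gauss ..

interpretation cgauss: prob_space cgauss
  unfolding cgauss_def by (rule real_gauss2.prob_space_distr) measurable

text \<open>For \<open>a\<close> nonzero a plane rotation is a composition of two one-dimensional
  affine substitutions, first in \<open>x\<close> for fixed \<open>y\<close>, then in
  \<open>y\<close> for fixed \<open>p = a * x + b * y\<close>. Their Jacobians \<open>1 / a\<close>
  and \<open>a\<close> cancel. For \<open>a = 0\<close> the rotation is a swap of the coordinates
  with a sign.\<close>

lemma nn_integral_lborel_rotation:
  fixes a b :: real
  assumes F [measurable]: "(\<lambda>(x, y). F x y) \<in> borel_measurable (borel \<Otimes>\<^sub>M borel)"
    and ab: "a\<^sup>2 + b\<^sup>2 = 1"
  shows "(\<integral>\<^sup>+x. \<integral>\<^sup>+y. F (a * x + b * y) (a * y - b * x) \<partial>lborel \<partial>lborel) =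
         (\<integral>\<^sup>+x. \<integral>\<^sup>+y. F x y \<partial>lborel \<partial>lborel)"
proof (cases "a = 0")
  case True
  then have b: "b = 1 \<or> b = -1"
    using ab by (simp add: power2_eq_1_iff)
  have unit: "(\<integral>\<^sup>+y. H (c * y) \<partial>lborel) = (\<integral>\<^sup>+y. H y \<partial>lborel)"
    if "H \<in> borel_measurable borel" "c = 1 \<or> c = -1" for H and c :: real
    using nn_integral_real_affine[of H c 0] that by auto
  have "(\<integral>\<^sup>+x. \<integral>\<^sup>+y. F (b * y) (- b * x) \<partial>lborel \<partial>lborel) =
        (\<integral>\<^sup>+x. \<integral>\<^sup>+y. F y (- b * x) \<partial>lborel \<partial>lborel)"
    using b by (intro nn_integral_cong unit) auto
  also have "\<dots> = (\<integral>\<^sup>+x. \<integral>\<^sup>+y. F y x \<partial>lborel \<partial>lborel)"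
    using b by (intro unit) auto
  also have "\<dots> = (\<integral>\<^sup>+x. \<integral>\<^sup>+y. F x y \<partial>lborel \<partial>lborel)"
    by (rule lborel_pair.Fubini') measurable
  finally show ?thesis
    using True by simp
next
  case False
  have "(\<integral>\<^sup>+x. \<integral>\<^sup>+y. F (a * x + b * y) (a * y - b * x) \<partial>lborel \<partial>lborel) =
        (\<integral>\<^sup>+y. \<integral>\<^sup>+x. F (a * x + b * y) (a * y - b * x) \<partial>lborel \<partial>lborel)"
    by (rule lborel_pair.Fubini') measurable
  also have "\<dots> = (\<integral>\<^sup>+y. \<integral>\<^sup>+p. ennreal \<bar>1 / a\<bar> * F p (y / a - b / a * p) \<partial>lborel \<partial>lborel)"
  proof (rule nn_integral_cong)
    fix y :: real
    \<comment> \<open>Solving \<open>p = a * x + b * y\<close> for \<open>x\<close> and substituting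
      into the second coordinate leaves \<open>y / a - b / a * p\<close>, because
      \<open>a\<^sup>2 + b\<^sup>2 = 1\<close>.\<close>
    have "a * (1 / a * p - b * y / a) + b * y = p" for p
      using False by (simp add: field_simps)
    moreover have "a * y - b * (1 / a * p - b * y / a) = y / a - b / a * p" for p
    proof -
      have "a * y - b * (1 / a * p - b * y / a) = (a\<^sup>2 + b\<^sup>2) * y / a - b / a * p"
        using False by (simp add: field_simps power2_eq_square)
      then show ?thesis by (simp add: ab)
    qed
    ultimately show "(\<integral>\<^sup>+x. F (a * x + b * y) (a * y - b * x) \<partial>lborel) =
        (\<integral>\<^sup>+p. ennreal \<bar>1 / a\<bar> * F p (y / a - b / a * p) \<partial>lborel)"
      using False
      by (subst nn_integral_real_affine[where c = "1 / a" and t = "- b * y / a"])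
         (auto simp: nn_integral_cmult add.commute)
  qed
  also have "\<dots> = (\<integral>\<^sup>+p. \<integral>\<^sup>+y. ennreal \<bar>1 / a\<bar> * F p (y / a - b / a * p) \<partial>lborel \<partial>lborel)"
    by (rule lborel_pair.Fubini') measurable
  also have "\<dots> = (\<integral>\<^sup>+p. \<integral>\<^sup>+y. F p y \<partial>lborel \<partial>lborel)"
  proof (rule nn_integral_cong)
    fix p :: real
    have "(b * p + a * y) / a - b / a * p = y" for y
      using False by (simp add: field_simps)
    then show "(\<integral>\<^sup>+y. ennreal \<bar>1 / a\<bar> * F p (y / a - b / a * p) \<partial>lborel) = (\<integral>\<^sup>+y. F p y \<partial>lborel)"
      using False
      by (subst nn_integral_real_affine[where c = a and t = "b * p"])
         (auto simp: nn_integral_cmult mult.assoc[symmetric] ennreal_mult[symmetric])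
  qed
  finally show ?thesis .
qed

text \<open>The product of the two densities is a function of \<open>x\<^sup>2 + y\<^sup>2\<close>,
  which the rotation preserves, so the invariance of Lebesgue measure carries over.\<close>

lemma nn_integral_real_gauss_rotation:
  fixes a b :: real
  assumes F [measurable]: "(\<lambda>(x, y). F x y) \<in> borel_measurable (borel \<Otimes>\<^sub>M borel)"
    and ab: "a\<^sup>2 + b\<^sup>2 = 1"
  shows "(\<integral>\<^sup>+x. \<integral>\<^sup>+y. F (a * x + b * y) (a * y - b * x) \<partial>real_gauss \<partial>real_gauss) =
         (\<integral>\<^sup>+x. \<integral>\<^sup>+y. F x y \<partial>real_gauss \<partial>real_gauss)"
proof -
  let ?d = "\<lambda>x. ennreal (normal_density 0 (sqrt (1 / 2)) x)"
  have *: "(\<integral>\<^sup>+x. \<integral>\<^sup>+y. H x y \<partial>real_gauss \<partial>real_gauss) =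
      (\<integral>\<^sup>+x. \<integral>\<^sup>+y. ?d x * ?d y * H x y \<partial>lborel \<partial>lborel)"
    if [measurable]: "(\<lambda>(x, y). H x y) \<in> borel_measurable (borel \<Otimes>\<^sub>M borel)" for H
    unfolding real_gauss_def
    by (simp add: nn_integral_density nn_integral_cmult[symmetric] mult.assoc)
  have d: "?d x * ?d y = ?d (a * x + b * y) * ?d (a * y - b * x)" for x y
  proof -
    have "(a * x + b * y)\<^sup>2 + (a * y - b * x)\<^sup>2 = (a\<^sup>2 + b\<^sup>2) * (x\<^sup>2 + y\<^sup>2)"
      by algebra
    then have "x\<^sup>2 + y\<^sup>2 = (a * x + b * y)\<^sup>2 + (a * y - b * x)\<^sup>2"
      by (simp add: ab)
    then have "exp (- x\<^sup>2) * exp (- y\<^sup>2) = exp (- (a * x + b * y)\<^sup>2) * exp (- (a * y - b * x)\<^sup>2)"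
      by (simp add: exp_add[symmetric])
    then show ?thesis
      by (simp add: ennreal_mult[symmetric] normal_density_def field_simps)
  qed
  show ?thesis
    using nn_integral_lborel_rotation[OF _ ab, of "\<lambda>x y. ?d x * ?d y * F x y"]
    by (simp add: * d[symmetric])
qed

lemma nn_integral_cgauss:
  assumes [measurable]: "F \<in> borel_measurable borel"
  shows "(\<integral>\<^sup>+z. F z \<partial>cgauss) = (\<integral>\<^sup>+x. \<integral>\<^sup>+y. F (Complex x y) \<partial>real_gauss \<partial>real_gauss)"
  unfolding cgauss_def
  by (simp add: nn_integral_distr real_gauss.nn_integral_fst[symmetric] split_def)

text \<open>Multiplication by \<open>c\<close> rotates the pair of real and imaginary part, with
  coefficients \<open>Re c\<close> and \<open>- Im c\<close>.\<close>

lemma nn_integral_cgauss_phase: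
  assumes [measurable]: "F \<in> borel_measurable borel" and c: "cmod c = 1"
  shows "(\<integral>\<^sup>+z. F (c * z) \<partial>cgauss) = (\<integral>\<^sup>+z. F z \<partial>cgauss)"
proof -
  have "(Re c)\<^sup>2 + (- Im c)\<^sup>2 = 1"
    using c cmod_power2[of c] by simp
  from nn_integral_real_gauss_rotation[OF _ this, of "\<lambda>x y. F (Complex x y)"]
  show ?thesis
    by (simp add: nn_integral_cgauss complex_eq_iff mult.commute
      arg_cong[where f = F, OF complex_eqI, of "c * Complex x y" "Complex (Re c * x - Im c * y) (Re c * y + Im c * x)" for x y])
qed

text \<open>A real rotation of two complex numbers acts separately on the two real parts and on the
  two imaginary parts. After reordering the four integrals the real rotation applies to each of
  these pairs.\<close>

lemma nn_integral_cgauss_rotation: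
  fixes a b :: real
  assumes F [measurable]: "(\<lambda>(x, y). F x y) \<in> borel_measurable (borel \<Otimes>\<^sub>M borel)"
    and ab: "a\<^sup>2 + b\<^sup>2 = 1"
  shows "(\<integral>\<^sup>+x. \<integral>\<^sup>+y. F (of_real a * x + of_real b * y) (of_real a * y - of_real b * x) \<partial>cgauss \<partial>cgauss) =
         (\<integral>\<^sup>+x. \<integral>\<^sup>+y. F x y \<partial>cgauss \<partial>cgauss)"
proof -
  have *: "(\<integral>\<^sup>+x. \<integral>\<^sup>+y. H x y \<partial>cgauss \<partial>cgauss) =
      (\<integral>\<^sup>+x1. \<integral>\<^sup>+y1. \<integral>\<^sup>+x2. \<integral>\<^sup>+y2. H (Complex x1 x2) (Complex y1 y2)
         \<partial>real_gauss \<partial>real_gauss \<partial>real_gauss \<partial>real_gauss)"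
    if [measurable]: "(\<lambda>(x, y). H x y) \<in> borel_measurable (borel \<Otimes>\<^sub>M borel)" for H
  proof -
    have "(\<integral>\<^sup>+x. \<integral>\<^sup>+y. H x y \<partial>cgauss \<partial>cgauss) =
      (\<integral>\<^sup>+x1. \<integral>\<^sup>+x2. \<integral>\<^sup>+y1. \<integral>\<^sup>+y2. H (Complex x1 x2) (Complex y1 y2)
         \<partial>real_gauss \<partial>real_gauss \<partial>real_gauss \<partial>real_gauss)"
      by (simp add: nn_integral_cgauss)
    also have "\<dots> = (\<integral>\<^sup>+x1. \<integral>\<^sup>+y1. \<integral>\<^sup>+x2. \<integral>\<^sup>+y2. H (Complex x1 x2) (Complex y1 y2)
         \<partial>real_gauss \<partial>real_gauss \<partial>real_gauss \<partial>real_gauss)"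
      by (intro nn_integral_cong real_gauss2.Fubini') measurable
    finally show ?thesis .
  qed
  have C: "of_real a * Complex x1 x2 + of_real b * Complex y1 y2 = Complex (a * x1 + b * y1) (a * x2 + b * y2)"
    "of_real a * Complex x1 x2 - of_real b * Complex y1 y2 = Complex (a * x1 - b * y1) (a * x2 - b * y2)"
    for a b x1 x2 y1 y2
    by (simp_all add: complex_eq_iff)
  have "(\<integral>\<^sup>+x. \<integral>\<^sup>+y. F (of_real a * x + of_real b * y) (of_real a * y - of_real b * x) \<partial>cgauss \<partial>cgauss) =
      (\<integral>\<^sup>+x1. \<integral>\<^sup>+y1. \<integral>\<^sup>+x2. \<integral>\<^sup>+y2. F (Complex (a * x1 + b * y1) (a * x2 + b * y2)) (Complex (a * y1 - b * x1) (a * y2 - b * x2))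
         \<partial>real_gauss \<partial>real_gauss \<partial>real_gauss \<partial>real_gauss)"
    by (subst *) (simp_all add: C)
  also have "\<dots> = (\<integral>\<^sup>+x1. \<integral>\<^sup>+y1. \<integral>\<^sup>+x2. \<integral>\<^sup>+y2. F (Complex (a * x1 + b * y1) x2) (Complex (a * y1 - b * x1) y2)
         \<partial>real_gauss \<partial>real_gauss \<partial>real_gauss \<partial>real_gauss)"
    by (intro nn_integral_cong nn_integral_real_gauss_rotation[OF _ ab]) measurable
  also have "\<dots> = (\<integral>\<^sup>+x1. \<integral>\<^sup>+y1. \<integral>\<^sup>+x2. \<integral>\<^sup>+y2. F (Complex x1 x2) (Complex y1 y2)
         \<partial>real_gauss \<partial>real_gauss \<partial>real_gauss \<partial>real_gauss)"
    by (rule nn_integral_real_gauss_rotation[OF _ ab]) measurable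
  also have "\<dots> = (\<integral>\<^sup>+x. \<integral>\<^sup>+y. F x y \<partial>cgauss \<partial>cgauss)"
    by (rule *[symmetric]) measurable
  finally show ?thesis .
qed

section \<open>Characteristic functions of the Gaussian laws\<close>

lemma char_real_gauss: "(\<integral>x. iexp (t * x) \<partial>real_gauss) = exp (- t\<^sup>2 / 4)"
proof -
  have "distributed std_normal_distribution lborel (\<lambda>x. x) std_normal_density"
    by (auto simp: distributed_def distr_id2)
  from prob_space.normal_density_affine[OF real_dist_normal_dist[THEN real_distribution.axioms(1)] this,
      where \<alpha> = "sqrt (1 / 2)" and \<beta> = 0]
  \<comment> \<open>Variance 1/2 makes this law a standard normal scaled by
    \<open>sqrt (1 / 2)\<close>, which is where the 4 in the exponent comes from.\<close>
  have "distr std_normal_distribution lborel (\<lambda>x. sqrt (1 / 2) * x) = real_gauss"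
    by (simp add: distributed_def real_gauss_def)
  then have "(\<integral>x. iexp (t * x) \<partial>real_gauss) =
      (\<integral>x. iexp (t * x) \<partial>distr std_normal_distribution lborel (\<lambda>x. sqrt (1 / 2) * x))"
    by simp
  also have "\<dots> = (\<integral>x. iexp (t * (sqrt (1 / 2) * x)) \<partial>std_normal_distribution)"
    by (subst integral_distr) auto
  also have "\<dots> = char std_normal_distribution (t * sqrt (1 / 2))"
    by (simp add: char_def mult.assoc)
  also have "\<dots> = exp (- (t * sqrt (1 / 2))\<^sup>2 / 2)"
    by (simp only: char_std_normal_distribution)
  also have "- (t * sqrt (1 / 2))\<^sup>2 / 2 = - t\<^sup>2 / 4"
    by (simp add: power_mult_distrib)
  finally show ?thesis .
qed

lemma char_cgauss: "(\<integral>z. iexp (Re (c * z)) \<partial>cgauss) = exp (- (cmod c)\<^sup>2 / 4)"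
proof -
  have "(\<integral>z. iexp (Re (c * z)) \<partial>cgauss) =
      (\<integral>p. iexp (Re c * fst p) * iexp (- Im c * snd p) \<partial>(real_gauss \<Otimes>\<^sub>M real_gauss))"
    unfolding cgauss_def
    by (subst integral_distr) (auto simp: split_def right_diff_distrib exp_diff exp_minus field_simps)
  also have "\<dots> = (\<integral>x. iexp (Re c * x) \<partial>real_gauss) * (\<integral>x. iexp (- Im c * x) \<partial>real_gauss)"
    by (subst real_gauss2.integral_fst'[symmetric])
       (auto intro!: real_gauss2.P.integrable_const_bound[where B = 1] simp: norm_mult)
  also have "\<dots> = exp (- (cmod c)\<^sup>2 / 4)"
    unfolding char_real_gauss
    by (simp add: cmod_power2 exp_add[symmetric] field_simps flip: exp_of_real)
  finally show ?thesis .
qed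

text \<open>A linear map of pairs that preserves the law of one coordinate pair preserves the law of
  a pair of Gaussian vectors when applied coordinatewise; the proof adds one coordinate at a time.
  The coefficients are left general to cover both rotations of two copies and a phase acting on one
  copy.\<close>

lemma nn_integral_PiM_cgauss_linear:
  fixes c1 c2 c3 c4 :: complex
  assumes "finite R"
    and inv: "\<And>F. (\<lambda>(x, y). F x y) \<in> borel_measurable (borel \<Otimes>\<^sub>M borel) \<Longrightarrow>
       (\<integral>\<^sup>+x. \<integral>\<^sup>+y. F (c1 * x + c2 * y) (c3 * x + c4 * y) \<partial>cgauss \<partial>cgauss) =
       (\<integral>\<^sup>+x. \<integral>\<^sup>+y. F x y \<partial>cgauss \<partial>cgauss)"
    and "(\<lambda>(x, y). F x y) \<in> borel_measurable (PiM R (\<lambda>_. cgauss) \<Otimes>\<^sub>M PiM R (\<lambda>_. cgauss))"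
  shows "(\<integral>\<^sup>+y. \<integral>\<^sup>+z. F (\<lambda>i\<in>R. c1 * y i + c2 * z i) (\<lambda>i\<in>R. c3 * y i + c4 * z i)
            \<partial>PiM R (\<lambda>_. cgauss) \<partial>PiM R (\<lambda>_. cgauss)) =
         (\<integral>\<^sup>+y. \<integral>\<^sup>+z. F y z \<partial>PiM R (\<lambda>_. cgauss) \<partial>PiM R (\<lambda>_. cgauss))"
  using assms(1,3)
proof (induction R arbitrary: F)
  case empty
  then show ?case
    by (intro nn_integral_cong) (auto simp: space_PiM)
next
  case (insert i R)
  interpret product_prob_space "\<lambda>_. cgauss" R ..
  interpret PP: pair_prob_space cgauss "PiM R (\<lambda>_. cgauss)" ..
  note [measurable] = insert.prems
  note [simp] = insert.hyps
  let ?P = "PiM R (\<lambda>_. cgauss)"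
  have split: "(\<integral>\<^sup>+y. \<integral>\<^sup>+z. G y z \<partial>PiM (insert i R) (\<lambda>_. cgauss) \<partial>PiM (insert i R) (\<lambda>_. cgauss)) =
     (\<integral>\<^sup>+y. \<integral>\<^sup>+z. \<integral>\<^sup>+s. \<integral>\<^sup>+t. G (y(i := s)) (z(i := t)) \<partial>cgauss \<partial>cgauss \<partial>?P \<partial>?P)"
    if [measurable]: "(\<lambda>(x, y). G x y) \<in> borel_measurable
      (PiM (insert i R) (\<lambda>_. cgauss) \<Otimes>\<^sub>M PiM (insert i R) (\<lambda>_. cgauss))" for G
  proof -
    have "(\<integral>\<^sup>+y. \<integral>\<^sup>+z. G y z \<partial>PiM (insert i R) (\<lambda>_. cgauss) \<partial>PiM (insert i R) (\<lambda>_. cgauss)) =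
      (\<integral>\<^sup>+y. \<integral>\<^sup>+s. \<integral>\<^sup>+z. \<integral>\<^sup>+t. G (y(i := s)) (z(i := t)) \<partial>cgauss \<partial>?P \<partial>cgauss \<partial>?P)"
      by (simp add: product_nn_integral_insert cong: nn_integral_cong)
    also have "\<dots> = (\<integral>\<^sup>+y. \<integral>\<^sup>+z. \<integral>\<^sup>+s. \<integral>\<^sup>+t. G (y(i := s)) (z(i := t)) \<partial>cgauss \<partial>cgauss \<partial>?P \<partial>?P)"
      by (intro nn_integral_cong PP.Fubini'[symmetric]) measurable
    finally show ?thesis .
  qed
  have "(\<integral>\<^sup>+y. \<integral>\<^sup>+z. F (\<lambda>j\<in>insert i R. c1 * y j + c2 * z j) (\<lambda>j\<in>insert i R. c3 * y j + c4 * z j)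
      \<partial>PiM (insert i R) (\<lambda>_. cgauss) \<partial>PiM (insert i R) (\<lambda>_. cgauss)) =
    (\<integral>\<^sup>+y. \<integral>\<^sup>+z. \<integral>\<^sup>+s. \<integral>\<^sup>+t. F ((\<lambda>j\<in>R. c1 * y j + c2 * z j)(i := c1 * s + c2 * t))
        ((\<lambda>j\<in>R. c3 * y j + c4 * z j)(i := c3 * s + c4 * t)) \<partial>cgauss \<partial>cgauss \<partial>?P \<partial>?P)"
  proof -
    have "(\<lambda>j\<in>insert i R. c * (y(i := s)) j + d * (z(i := t)) j) =
        (\<lambda>j\<in>R. c * y j + d * z j)(i := c * s + d * t)" for c d s t :: complex and y z
      using insert.hyps by (auto simp: fun_eq_iff)
    then show ?thesis
      by (subst split) (simp_all)
  qed
  also have "\<dots> = (\<integral>\<^sup>+y. \<integral>\<^sup>+z. \<integral>\<^sup>+s. \<integral>\<^sup>+t. F ((\<lambda>j\<in>R. c1 * y j + c2 * z j)(i := s))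
        ((\<lambda>j\<in>R. c3 * y j + c4 * z j)(i := t)) \<partial>cgauss \<partial>cgauss \<partial>?P \<partial>?P)"
    \<comment> \<open>With the new coordinate integrated innermost, the old ones are constants and
      the hypothesis \<open>inv\<close> applies.\<close>
    by (intro nn_integral_cong inv) measurable
  also have "\<dots> = (\<integral>\<^sup>+y. \<integral>\<^sup>+z. \<integral>\<^sup>+s. \<integral>\<^sup>+t. F (y(i := s)) (z(i := t)) \<partial>cgauss \<partial>cgauss \<partial>?P \<partial>?P)"
    by (rule insert.IH[of "\<lambda>y z. \<integral>\<^sup>+s. \<integral>\<^sup>+t. F (y(i := s)) (z(i := t)) \<partial>cgauss \<partial>cgauss"]) measurable
  also have "\<dots> = (\<integral>\<^sup>+y. \<integral>\<^sup>+z. F y z \<partial>PiM (insert i R) (\<lambda>_. cgauss) \<partial>PiM (insert i R) (\<lambda>_. cgauss))"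
    by (rule split[symmetric]) measurable
  finally show ?case .
qed

section \<open>Gaussian vectors\<close>

lemma (in pair_prob_space) integral_mult_fst_snd:
  fixes f g :: "_ \<Rightarrow> _::{real_normed_field, banach, second_countable_topology}"
  assumes [measurable]: "f \<in> borel_measurable M1" "g \<in> borel_measurable M2"
    and "\<And>x. norm (f x) \<le> 1" "\<And>y. norm (g y) \<le> 1"
  shows "(\<integral>p. f (fst p) * g (snd p) \<partial>(M1 \<Otimes>\<^sub>M M2)) = (\<integral>x. f x \<partial>M1) * (\<integral>y. g y \<partial>M2)"
proof -
  have "integrable (M1 \<Otimes>\<^sub>M M2) (\<lambda>p. f (fst p) * g (snd p))"
    by (rule P.integrable_const_bound[where B = 1])
       (use assms mult_mono[OF assms(3,4), of _ _] in \<open>auto simp: norm_mult mult_le_one\<close>)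
  then show ?thesis
    by (subst integral_fst'[symmetric]) auto
qed

abbreviation gauss_vec :: "'i set \<Rightarrow> ('i \<Rightarrow> complex) measure" where
  "gauss_vec R \<equiv> PiM R (\<lambda>_. cgauss)"

interpretation gauss_vec: prob_space "gauss_vec R" for R
  by (intro prob_space_PiM) unfold_locales

interpretation gauss_vec2: pair_prob_space "gauss_vec R" "gauss_vec S" for R S ..

text \<open>Stating the invariance as an equality of measures makes it available for Bochner
  integrals of complex functions, beyond the nonnegative integrals treated so far.\<close>

lemma distr_gauss_vec_linear:
  fixes c1 c2 c3 c4 :: complex
  assumes "finite R"
    and inv: "\<And>F. (\<lambda>(x, y). F x y) \<in> borel_measurable (borel \<Otimes>\<^sub>M borel) \<Longrightarrow>
       (\<integral>\<^sup>+x. \<integral>\<^sup>+y. F (c1 * x + c2 * y) (c3 * x + c4 * y) \<partial>cgauss \<partial>cgauss) =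
       (\<integral>\<^sup>+x. \<integral>\<^sup>+y. F x y \<partial>cgauss \<partial>cgauss)"
  shows "distr (gauss_vec R \<Otimes>\<^sub>M gauss_vec R) (gauss_vec R \<Otimes>\<^sub>M gauss_vec R)
      (\<lambda>p. (\<lambda>i\<in>R. c1 * fst p i + c2 * snd p i, \<lambda>i\<in>R. c3 * fst p i + c4 * snd p i)) =
    gauss_vec R \<Otimes>\<^sub>M gauss_vec R" (is "distr ?M _ ?T = _")
proof (rule measure_eqI)
  fix A assume "A \<in> sets (distr ?M ?M ?T)"
  then have [measurable]: "A \<in> sets ?M" by simp
  have "emeasure (distr ?M ?M ?T) A = (\<integral>\<^sup>+p. indicator A p \<partial>distr ?M ?M ?T)"
    by simp
  also have "\<dots> = (\<integral>\<^sup>+p. indicator A (?T p) \<partial>?M)"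
    by (subst nn_integral_distr) auto
  also have "\<dots> = (\<integral>\<^sup>+y. \<integral>\<^sup>+z. indicator A (?T (y, z)) \<partial>gauss_vec R \<partial>gauss_vec R)"
    by (rule gauss_vec.nn_integral_fst[symmetric]) measurable
  also have "\<dots> = (\<integral>\<^sup>+y. \<integral>\<^sup>+z. indicator A (y, z) \<partial>gauss_vec R \<partial>gauss_vec R)"
    using nn_integral_PiM_cgauss_linear[OF assms, of "\<lambda>y z. indicator A (y, z)"] by simp
  also have "\<dots> = (\<integral>\<^sup>+p. indicator A p \<partial>?M)"
    by (rule gauss_vec.nn_integral_fst) measurable
  finally show "emeasure (distr ?M ?M ?T) A = emeasure ?M A"
    by simp
qed simp

lemma distr_gauss_vec_rotation:
  fixes a b :: real
  assumes "finite R" "a\<^sup>2 + b\<^sup>2 = 1"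
  shows "distr (gauss_vec R \<Otimes>\<^sub>M gauss_vec R) (gauss_vec R \<Otimes>\<^sub>M gauss_vec R)
      (\<lambda>p. (\<lambda>i\<in>R. of_real a * fst p i + of_real b * snd p i,
            \<lambda>i\<in>R. - of_real b * fst p i + of_real a * snd p i)) =
    gauss_vec R \<Otimes>\<^sub>M gauss_vec R"
proof (rule distr_gauss_vec_linear[OF assms(1)])
  fix F :: "complex \<Rightarrow> complex \<Rightarrow> ennreal"
  assume "(\<lambda>(x, y). F x y) \<in> borel_measurable (borel \<Otimes>\<^sub>M borel)"
  from nn_integral_cgauss_rotation[OF this assms(2)]
  show "(\<integral>\<^sup>+x. \<integral>\<^sup>+y. F (of_real a * x + of_real b * y) (- of_real b * x + of_real a * y)
      \<partial>cgauss \<partial>cgauss) = (\<integral>\<^sup>+x. \<integral>\<^sup>+y. F x y \<partial>cgauss \<partial>cgauss)"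
    by simp
qed

lemma distr_gauss_vec_phase:
  assumes "finite R" "cmod c = 1"
  shows "distr (gauss_vec R) (gauss_vec R) (\<lambda>y. \<lambda>i\<in>R. c * y i) = gauss_vec R"
proof (rule measure_eqI)
  fix A assume "A \<in> sets (distr (gauss_vec R) (gauss_vec R) (\<lambda>y. \<lambda>i\<in>R. c * y i))"
  then have [measurable]: "A \<in> sets (gauss_vec R)" by simp
  \<comment> \<open>The phase acts on the first copy only; the second copy is left unchanged and
    integrates to 1.\<close>
  have "(\<integral>\<^sup>+x. \<integral>\<^sup>+y. F (c * x + 0 * y) (0 * x + 1 * y) \<partial>cgauss \<partial>cgauss) =
       (\<integral>\<^sup>+x. \<integral>\<^sup>+y. F x y \<partial>cgauss \<partial>cgauss)"
    if [measurable]: "(\<lambda>(x, y). F x y) \<in> borel_measurable (borel \<Otimes>\<^sub>M borel)" for F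
    using nn_integral_cgauss_phase[OF _ assms(2), of "\<lambda>x. \<integral>\<^sup>+y. F x y \<partial>cgauss"] by simp
  from nn_integral_PiM_cgauss_linear[OF assms(1) this, of "\<lambda>y z. indicator A y"]
  have "(\<integral>\<^sup>+y. indicator A (\<lambda>i\<in>R. c * y i) \<partial>gauss_vec R) = (\<integral>\<^sup>+y. indicator A y \<partial>gauss_vec R)"
    by (simp add: gauss_vec.emeasure_space_1)
  then show "emeasure (distr (gauss_vec R) (gauss_vec R) (\<lambda>y. \<lambda>i\<in>R. c * y i)) A =
      emeasure (gauss_vec R) A"
    by (subst nn_integral_indicator[symmetric], simp, subst nn_integral_distr) auto
qed simp

text \<open>The exponential of the sum is a product over independent coordinates, and each factor is
  given by \<open>char_cgauss\<close>.\<close>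

lemma char_gauss_vec:
  assumes "finite R"
  shows "(\<integral>z. iexp (Re (\<Sum>j\<in>R. d j * z j)) \<partial>gauss_vec R) = of_real (exp (- (\<Sum>j\<in>R. (cmod (d j))\<^sup>2) / 4))"
proof -
  interpret product_prob_space "\<lambda>_. cgauss" R ..
  have "(\<integral>z. iexp (Re (\<Sum>j\<in>R. d j * z j)) \<partial>gauss_vec R) =
      (\<integral>z. (\<Prod>j\<in>R. iexp (Re (d j * z j))) \<partial>gauss_vec R)"
    by (simp only: Re_sum of_real_sum sum_distrib_left exp_sum[OF assms])
  also have "\<dots> = (\<Prod>j\<in>R. \<integral>z. iexp (Re (d j * z)) \<partial>cgauss)"
    by (intro product_integral_prod[OF assms] cgauss.integrable_const_bound[where B = 1]) auto
  also have "\<dots> = of_real (exp (- (\<Sum>j\<in>R. (cmod (d j))\<^sup>2) / 4))"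
    by (simp only: char_cgauss)
       (simp add: exp_sum[OF assms, symmetric] sum_negf sum_divide_distrib flip: exp_of_real)
  finally show ?thesis .
qed

section \<open>Gaussian integrals of a symmetric bilinear form\<close>

lemma cmod_parallelogram: "(cmod x)\<^sup>2 + (cmod y)\<^sup>2 = ((cmod (x + y))\<^sup>2 + (cmod (x - y))\<^sup>2) / 2"
  unfolding cmod_power2 by (simp add: power2_eq_square algebra_simps)

lemma iexp_mult_cnj: "iexp a * cnj (iexp b) = iexp (a - b)"
  by (simp add: exp_cnj exp_diff exp_minus divide_inverse right_diff_distrib)

lemma borel_measurable_cnj [measurable (raw)]:
  assumes "f \<in> borel_measurable M"
  shows "(\<lambda>x. cnj (f x)) \<in> borel_measurable M"
  using measurable_compose[OF assms borel_measurable_continuous_onI[of cnj]]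
  by (simp add: continuous_on_cnj)

text \<open>Here \<open>l\<close> holds the coefficients of the linear form L and \<open>q\<close>
  those of the symmetric bilinear form Q. The exponent studied is u L(z) + v L(y) + Q(y, z), and
  \<open>row y\<close> is the coefficient vector of Q(y, z) as a linear form in z.\<close>

locale symmetric_form =
  fixes R :: "'i set" and l :: "'i \<Rightarrow> complex" and q :: "'i \<Rightarrow> 'i \<Rightarrow> complex"
  assumes fin [simp]: "finite R"
    and sym: "\<And>i j. i \<in> R \<Longrightarrow> j \<in> R \<Longrightarrow> q i j = q j i"
begin

definition lin :: "('i \<Rightarrow> complex) \<Rightarrow> complex" where
  "lin y = (\<Sum>j\<in>R. l j * y j)"

definition row :: "('i \<Rightarrow> complex) \<Rightarrow> 'i \<Rightarrow> complex" where
  "row y j = (\<Sum>i\<in>R. q i j * y i)"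

text \<open>The Gaussian average over z of \<open>iexp\<close> of the real part of u L(z) + Q(y,
  z).\<close>

definition damp :: "complex \<Rightarrow> ('i \<Rightarrow> complex) \<Rightarrow> real" where
  "damp u y = exp (- (\<Sum>j\<in>R. (cmod (u * l j + row y j))\<^sup>2) / 4)"

text \<open>The Gaussian average of \<open>iexp\<close> of the real part of the whole exponent, with
  the z-integral already carried out. Its value at \<open>v = 0\<close> is
  \<open>mass u\<close>.\<close>

definition osc :: "complex \<Rightarrow> complex \<Rightarrow> complex" where
  "osc u v = (\<integral>y. iexp (Re (v * lin y)) * of_real (damp u y) \<partial>gauss_vec R)"

definition mass :: "complex \<Rightarrow> real" where
  "mass u = (\<integral>y. damp u y \<partial>gauss_vec R)"

lemma measurable_lin [measurable]: "lin \<in> borel_measurable (gauss_vec R)"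
  unfolding lin_def by measurable

lemma measurable_row [measurable]: "(\<lambda>y. row y j) \<in> borel_measurable (gauss_vec R)"
  unfolding row_def by measurable

lemma measurable_damp [measurable]: "damp u \<in> borel_measurable (gauss_vec R)"
  unfolding damp_def by measurable

lemma damp_pos: "0 < damp u y" and damp_le_1: "damp u y \<le> 1"
  by (auto simp: damp_def intro!: sum_nonneg)

lemma norm_damp: "\<bar>damp u y\<bar> \<le> 1"
  using damp_pos[of u y] damp_le_1[of u y] by simp

lemma mass_nonneg: "0 \<le> mass u"
  unfolding mass_def by (intro Bochner_Integration.integral_nonneg less_imp_le damp_pos)

lemma osc_eq_mass: "osc u 0 = of_real (mass u)"
  by (simp add: osc_def mass_def)

lemma lin_restrict [simp]: "lin (\<lambda>i\<in>R. y i) = lin y"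
  by (simp add: lin_def)

lemma row_restrict [simp]: "row (\<lambda>i\<in>R. y i) = row y"
  by (simp add: row_def fun_eq_iff)

lemma damp_restrict [simp]: "damp u (\<lambda>i\<in>R. y i) = damp u y"
  by (simp add: damp_def)

lemma lin_linear: "lin (\<lambda>i. a * y i + b * z i) = a * lin y + b * lin z"
  by (simp add: lin_def sum.distrib sum_distrib_left algebra_simps)

lemma row_linear: "row (\<lambda>i. a * y i + b * z i) j = a * row y j + b * row z j"
  by (simp add: row_def sum.distrib sum_distrib_left algebra_simps)

lemma integral_bilinear:
  "(\<integral>z. iexp (Re (u * lin z + v * lin y + (\<Sum>j\<in>R. row y j * z j))) \<partial>gauss_vec R) =
   iexp (Re (v * lin y)) * of_real (damp u y)"
proof -
  have "u * lin z + v * lin y + (\<Sum>j\<in>R. row y j * z j) =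
      v * lin y + (\<Sum>j\<in>R. (u * l j + row y j) * z j)" for z
    by (simp add: lin_def sum.distrib sum_distrib_left algebra_simps)
  then have "(\<integral>z. iexp (Re (u * lin z + v * lin y + (\<Sum>j\<in>R. row y j * z j))) \<partial>gauss_vec R) =
      (\<integral>z. iexp (Re (v * lin y)) * iexp (Re (\<Sum>j\<in>R. (u * l j + row y j) * z j)) \<partial>gauss_vec R)"
    by (simp only: plus_complex.simps of_real_add ring_distribs exp_add)
  also have "\<dots> = iexp (Re (v * lin y)) * (\<integral>z. iexp (Re (\<Sum>j\<in>R. (u * l j + row y j) * z j)) \<partial>gauss_vec R)"
    by (rule integral_mult_right_zero)
  also have "\<dots> = iexp (Re (v * lin y)) * of_real (damp u y)"
    by (simp only: char_gauss_vec[OF fin] damp_def)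
  finally show ?thesis .
qed

lemma osc_eq_iterated:
  "osc u v = (\<integral>y. \<integral>z. iexp (Re (u * lin z + v * lin y + (\<Sum>j\<in>R. row y j * z j)))
     \<partial>gauss_vec R \<partial>gauss_vec R)"
  by (simp only: integral_bilinear osc_def)

text \<open>This is Q(y, z) = Q(z, y), the place where the symmetry of \<open>q\<close>
  enters.\<close>

lemma bilinear_sym: "(\<Sum>j\<in>R. row y j * z j) = (\<Sum>j\<in>R. row z j * y j)"
  unfolding row_def sum_distrib_right
  by (subst sum.swap, intro sum.cong refl) (simp add: sym mult_ac)

text \<open>Exchanging the roles of y and z, by Fubini and the symmetry of Q, moves the linear term
  from y to z, where it is absorbed into the damping factor.\<close>

lemma osc_0: "osc 0 v = of_real (mass v)"
proof -
  have swap: "0 * lin z + v * lin y + (\<Sum>j\<in>R. row y j * z j) =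
      v * lin y + 0 * lin z + (\<Sum>j\<in>R. row z j * y j)" for y z
    by (subst bilinear_sym) simp
  have "osc 0 v = (\<integral>y. \<integral>z. iexp (Re (0 * lin z + v * lin y + (\<Sum>j\<in>R. row y j * z j)))
     \<partial>gauss_vec R \<partial>gauss_vec R)"
    by (rule osc_eq_iterated)
  also have "\<dots> = (\<integral>z. \<integral>y. iexp (Re (0 * lin z + v * lin y + (\<Sum>j\<in>R. row y j * z j)))
     \<partial>gauss_vec R \<partial>gauss_vec R)"
    by (intro gauss_vec2.Fubini_integral gauss_vec2.P.integrable_const_bound[where B = 1]) auto
  also have "\<dots> = (\<integral>z. \<integral>y. iexp (Re (v * lin y + 0 * lin z + (\<Sum>j\<in>R. row z j * y j)))
     \<partial>gauss_vec R \<partial>gauss_vec R)"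
    by (simp only: swap)
  also have "\<dots> = of_real (mass v)"
    by (simp only: osc_eq_iterated[symmetric] osc_eq_mass)
  finally show ?thesis .
qed

text \<open>The rotation by 45 degrees decouples two independent copies of the integral.\<close>

lemma cmod_osc_square: "(cmod (osc u v))\<^sup>2 = mass (of_real (sqrt 2) * u) * mass (of_real (sqrt 2) * v)"
proof -
  define w :: real where "w = 1 / sqrt 2"
  have w: "w\<^sup>2 + w\<^sup>2 = 1" and w2: "w * w = 1 / 2" and ws: "2 * w = sqrt 2"
    by (simp_all add: w_def power_divide real_div_sqrt)
  let ?P = "gauss_vec R"
  let ?T = "\<lambda>p. (\<lambda>i\<in>R. of_real w * fst p i + of_real w * snd p i,
            \<lambda>i\<in>R. - of_real w * fst p i + of_real w * snd p i)"
  let ?h = "\<lambda>y. iexp (Re (v * lin y)) * of_real (damp u y)"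
  have norm_h: "norm (?h y) \<le> 1" for y
    using norm_damp by (simp add: norm_mult)
  \<comment> \<open>The square of the modulus is an integral over two independent copies, which are
    now (y + z) / sqrt 2 and (z - y) / sqrt 2. The phase depends only on their difference, a
    multiple of y. By the parallelogram law the two damping factors multiply to one factor in y and
    one in z, so the integrand separates.\<close>
  have key: "?h (fst (?T p)) * cnj (?h (snd (?T p))) =
      (iexp (Re (of_real (sqrt 2) * v * lin (fst p))) * of_real (damp 0 (fst p))) *
      of_real (damp (of_real (sqrt 2) * u) (snd p))" for p
  proof -
    let ?A = "\<lambda>j. u * l j + row (fst (?T p)) j" and ?B = "\<lambda>j. u * l j + row (snd (?T p)) j"
    have A: "row (fst (?T p)) j = of_real w * (row (fst p) j + row (snd p) j)"
      and B: "row (snd (?T p)) j = of_real w * (row (snd p) j - row (fst p) j)" for j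
      by (simp_all only: fst_conv snd_conv row_restrict row_linear) (simp_all add: algebra_simps)
    have "?A j + ?B j = of_real (2 * w) * (of_real (sqrt 2) * u * l j + row (snd p) j)" for j
    proof -
      have "complex_of_real (2 * w) * complex_of_real (sqrt 2) = 2"
        by (simp add: ws flip: of_real_mult)
      then have "of_real (2 * w) * (of_real (sqrt 2) * u * l j + row (snd p) j) =
          2 * u * l j + of_real (2 * w) * row (snd p) j"
        by (simp only: ring_distribs mult.assoc[symmetric])
      then show ?thesis
        unfolding A B by (simp add: algebra_simps)
    qed
    moreover have "?A j - ?B j = of_real (2 * w) * row (fst p) j" for j
      unfolding A B by (simp add: algebra_simps)
    ultimately have AB: "(cmod (?A j))\<^sup>2 + (cmod (?B j))\<^sup>2 =
        (cmod (of_real (sqrt 2) * u * l j + row (snd p) j))\<^sup>2 + (cmod (0 * l j + row (fst p) j))\<^sup>2" for j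
      by (simp only: cmod_parallelogram[of "?A j"])
         (simp add: norm_mult power_mult_distrib ws)
    have "damp u (fst (?T p)) * damp u (snd (?T p)) =
        exp (- (\<Sum>j\<in>R. (cmod (?A j))\<^sup>2 + (cmod (?B j))\<^sup>2) / 4)"
      unfolding damp_def by (simp add: exp_add[symmetric] sum.distrib field_simps)
    also have "\<dots> = damp 0 (fst p) * damp (of_real (sqrt 2) * u) (snd p)"
      unfolding AB by (simp add: damp_def exp_add[symmetric] sum.distrib field_simps)
    finally have D: "damp u (fst (?T p)) * damp u (snd (?T p)) =
        damp 0 (fst p) * damp (of_real (sqrt 2) * u) (snd p)" .
    have "lin (fst (?T p)) - lin (snd (?T p)) = of_real (2 * w) * lin (fst p)"
      by (simp only: fst_conv snd_conv lin_restrict lin_linear) (simp add: algebra_simps)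
    then have "Re (v * lin (fst (?T p))) - Re (v * lin (snd (?T p))) = Re (of_real (sqrt 2) * v * lin (fst p))"
      unfolding ws by (simp only: minus_complex.simps(1)[symmetric] right_diff_distrib[symmetric] mult_ac)
    then have "iexp (Re (v * lin (fst (?T p)))) * cnj (iexp (Re (v * lin (snd (?T p))))) =
        iexp (Re (of_real (sqrt 2) * v * lin (fst p)))"
      by (simp only: iexp_mult_cnj)
    with D show ?thesis
      by (simp add: mult_ac flip: of_real_mult)
  qed
  have "of_real ((cmod (osc u v))\<^sup>2) = osc u v * cnj (osc u v)"
    by (rule complex_norm_square)
  also have "\<dots> = (\<integral>y. ?h y \<partial>?P) * (\<integral>y. cnj (?h y) \<partial>?P)"
    by (simp add: osc_def integral_cnj[symmetric] del: complex_cnj_mult)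
  also have "\<dots> = (\<integral>p. ?h (fst p) * cnj (?h (snd p)) \<partial>(?P \<Otimes>\<^sub>M ?P))"
  proof (rule gauss_vec2.integral_mult_fst_snd[symmetric])
    show "norm (cnj (?h y)) \<le> 1" for y
      by (simp only: complex_mod_cnj norm_h)
  qed (measurable, rule norm_h)
  also have "\<dots> = (\<integral>p. ?h (fst p) * cnj (?h (snd p)) \<partial>distr (?P \<Otimes>\<^sub>M ?P) (?P \<Otimes>\<^sub>M ?P) ?T)"
    by (simp only: distr_gauss_vec_rotation[OF fin w])
  also have "\<dots> = (\<integral>p. ?h (fst (?T p)) * cnj (?h (snd (?T p))) \<partial>(?P \<Otimes>\<^sub>M ?P))"
    by (rule integral_distr) measurable
  also have "\<dots> = (\<integral>p. (iexp (Re (of_real (sqrt 2) * v * lin (fst p))) * of_real (damp 0 (fst p))) *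
      of_real (damp (of_real (sqrt 2) * u) (snd p)) \<partial>(?P \<Otimes>\<^sub>M ?P))"
    by (simp only: key)
  also have "\<dots> = osc 0 (of_real (sqrt 2) * v) * of_real (mass (of_real (sqrt 2) * u))"
    unfolding osc_def mass_def integral_complex_of_real[symmetric]
    using norm_damp by (intro gauss_vec2.integral_mult_fst_snd) (auto simp: norm_mult)
  also have "\<dots> = of_real (mass (of_real (sqrt 2) * u) * mass (of_real (sqrt 2) * v))"
    by (simp add: osc_0)
  finally show ?thesis
    by (simp only: of_real_eq_iff)
qed

text \<open>The phase \<open>c\<close> of \<open>u\<close> is moved into y by the invariant
  substitution of \<open>c * y\<close> for y. It then factors out of
  \<open>u * l j + row y j\<close> and disappears in the modulus.\<close>

lemma mass_cmod: "mass (of_real (cmod u)) = mass u"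
proof (cases "u = 0")
  case False
  define c where "c = u / of_real (cmod u)"
  have c: "cmod c = 1" and u: "u = c * of_real (cmod u)"
    using False by (simp_all add: c_def norm_divide)
  have "mass u = (\<integral>y. damp u y \<partial>distr (gauss_vec R) (gauss_vec R) (\<lambda>y. \<lambda>i\<in>R. c * y i))"
    by (simp only: distr_gauss_vec_phase[OF fin c] mass_def)
  also have "\<dots> = (\<integral>y. damp u (\<lambda>i. c * y i) \<partial>gauss_vec R)"
    by (subst integral_distr) auto
  also have "\<dots> = mass (of_real (cmod u))"
  proof -
    have "u * l j + row (\<lambda>i. c * y i) j = c * (of_real (cmod u) * l j + row y j)" for j y
      using row_linear[of c y 0 y j] by (subst u) (simp add: algebra_simps)
    then show ?thesis
      by (simp add: mass_def damp_def norm_mult c)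
  qed
  finally show ?thesis by simp
qed simp

text \<open>A rotation of two independent copies takes the coefficient pair (r, r) to (a, b), and it
  preserves the sum of the two squared moduli in the exponents.\<close>

lemma mass_mult_real:
  fixes a b r :: real
  assumes r: "a\<^sup>2 + b\<^sup>2 = 2 * r\<^sup>2"
  shows "mass (of_real a) * mass (of_real b) = (mass (of_real r))\<^sup>2"
proof (cases "r = 0")
  case True
  with r have "a = 0 \<and> b = 0"
    by (simp add: sum_power2_eq_zero_iff)
  with True show ?thesis
    by (simp add: power2_eq_square)
next
  case False
  let ?P = "gauss_vec R"
  \<comment> \<open>These solve \<open>c * r + s * r = a\<close> and
    \<open>- s * r + c * r = b\<close>. The hypothesis on \<open>r\<close> makes them the entries of
    a rotation matrix.\<close>
  define c s where "c = (a + b) / (2 * r)" and "s = (a - b) / (2 * r)"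
  have cr: "c * r + s * r = a" "- s * r + c * r = b"
    using False by (simp_all add: c_def s_def field_simps)
  have "(a + b)\<^sup>2 + (a - b)\<^sup>2 = (2 * r)\<^sup>2"
    using r by (simp add: power2_eq_square algebra_simps)
  then have cs: "c\<^sup>2 + s\<^sup>2 = 1"
    using False by (simp add: c_def s_def power_divide add_divide_distrib[symmetric])
  let ?T = "\<lambda>p. (\<lambda>i\<in>R. of_real c * fst p i + of_real s * snd p i,
            \<lambda>i\<in>R. - of_real s * fst p i + of_real c * snd p i)"
  have key: "damp (of_real a) (fst (?T p)) * damp (of_real b) (snd (?T p)) =
      damp (of_real r) (fst p) * damp (of_real r) (snd p)" for p
  proof -
    let ?X = "\<lambda>j. of_real r * l j + row (fst p) j" and ?Y = "\<lambda>j. of_real r * l j + row (snd p) j"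
    have A: "of_real a * l j + row (fst (?T p)) j = of_real c * ?X j + of_real s * ?Y j"
      and B: "of_real b * l j + row (snd (?T p)) j = - of_real s * ?X j + of_real c * ?Y j" for j
      unfolding cr[symmetric]
      by (simp_all only: fst_conv snd_conv row_restrict row_linear) (simp_all add: algebra_simps)
    have rot: "(cmod (of_real c * x + of_real s * y))\<^sup>2 + (cmod (- of_real s * x + of_real c * y))\<^sup>2 =
        (cmod x)\<^sup>2 + (cmod y)\<^sup>2" for x y
    proof -
      have "(cmod (of_real c * x + of_real s * y))\<^sup>2 + (cmod (- of_real s * x + of_real c * y))\<^sup>2 =
        (c\<^sup>2 + s\<^sup>2) * ((cmod x)\<^sup>2 + (cmod y)\<^sup>2)"
        unfolding cmod_power2 by (simp add: power2_eq_square algebra_simps)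
      then show ?thesis by (simp add: cs)
    qed
    have "damp (of_real a) (fst (?T p)) * damp (of_real b) (snd (?T p)) =
        exp (- (\<Sum>j\<in>R. (cmod (of_real a * l j + row (fst (?T p)) j))\<^sup>2 +
          (cmod (of_real b * l j + row (snd (?T p)) j))\<^sup>2) / 4)"
      unfolding damp_def by (simp add: exp_add[symmetric] sum.distrib field_simps)
    also have "\<dots> = damp (of_real r) (fst p) * damp (of_real r) (snd p)"
      unfolding A B rot by (simp add: damp_def exp_add[symmetric] sum.distrib field_simps)
    finally show ?thesis .
  qed
  have "mass (of_real a) * mass (of_real b) =
      (\<integral>p. damp (of_real a) (fst p) * damp (of_real b) (snd p) \<partial>(?P \<Otimes>\<^sub>M ?P))"
    unfolding mass_def using norm_damp
    by (intro gauss_vec2.integral_mult_fst_snd[symmetric]) auto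
  also have "\<dots> = (\<integral>p. damp (of_real a) (fst p) * damp (of_real b) (snd p)
      \<partial>distr (?P \<Otimes>\<^sub>M ?P) (?P \<Otimes>\<^sub>M ?P) ?T)"
    by (simp only: distr_gauss_vec_rotation[OF fin cs])
  also have "\<dots> = (\<integral>p. damp (of_real a) (fst (?T p)) * damp (of_real b) (snd (?T p)) \<partial>(?P \<Otimes>\<^sub>M ?P))"
    by (rule integral_distr) measurable
  also have "\<dots> = (\<integral>p. damp (of_real r) (fst p) * damp (of_real r) (snd p) \<partial>(?P \<Otimes>\<^sub>M ?P))"
    by (simp only: key)
  also have "\<dots> = mass (of_real r) * mass (of_real r)"
    unfolding mass_def using norm_damp by (intro gauss_vec2.integral_mult_fst_snd) auto
  finally show ?thesis
    by (simp add: power2_eq_square)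
qed

text \<open>\<open>cmod_osc_square\<close> gives a product of two masses at sqrt 2 times the moduli
  of u and v; \<open>mass_mult_real\<close> merges them into the square of one mass, and
  nonnegativity permits taking the root.\<close>

lemma cmod_osc: "cmod (osc u v) = mass (of_real (sqrt ((cmod u)\<^sup>2 + (cmod v)\<^sup>2)))"
proof -
  have "(cmod (osc u v))\<^sup>2 =
      mass (of_real (cmod (of_real (sqrt 2) * u))) * mass (of_real (cmod (of_real (sqrt 2) * v)))"
    by (simp only: cmod_osc_square mass_cmod)
  also have "\<dots> = (mass (of_real (sqrt ((cmod u)\<^sup>2 + (cmod v)\<^sup>2))))\<^sup>2"
    by (rule mass_mult_real) (simp add: norm_mult power_mult_distrib)
  finally show ?thesis
    by (simp add: mass_nonneg)
qed

end

section \<open>Hafnians and Gaussian edge weights\<close>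

definition edges :: "'a set \<Rightarrow> 'a set set" where
  "edges V = {e. e \<subseteq> V \<and> card e = 2}"

text \<open>Weights are indexed by two-element sets, so the off-diagonal part of a symmetric matrix
  is a single function on \<open>edges V\<close>, with independent coordinates under
  \<open>gauss_vec (edges V)\<close>.\<close>

definition haf :: "'a set \<Rightarrow> ('a set \<Rightarrow> complex) \<Rightarrow> complex" where
  "haf V x = (\<Sum>M\<in>perfect_matchings V. \<Prod>e\<in>M. x e)"

lemma finite_edges [simp]: "finite V \<Longrightarrow> finite (edges V)"
  by (rule finite_subset[of _ "Pow V"]) (auto simp: edges_def)

lemma edges_mono: "V \<subseteq> W \<Longrightarrow> edges V \<subseteq> edges W"
  by (auto simp: edges_def)

lemma perfect_matchings_subset_edges: "M \<in> perfect_matchings V \<Longrightarrow> M \<subseteq> edges V"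
  by (auto simp: perfect_matchings_def partition_on_def edges_def)

lemma finite_perfect_matchings: "finite V \<Longrightarrow> finite (perfect_matchings V)"
  by (rule finite_subset[of _ "Pow (edges V)"]) (auto dest: perfect_matchings_subset_edges)

lemma haf_cong:
  assumes "\<And>e. e \<in> edges V \<Longrightarrow> x e = y e"
  shows "haf V x = haf V y"
  unfolding haf_def using assms perfect_matchings_subset_edges
  by (intro sum.cong prod.cong refl) blast

lemma haf_empty [simp]: "haf {} x = 1"
proof -
  have "perfect_matchings ({} :: 'a set) = {{}}"
    by (auto simp: perfect_matchings_def partition_on_def)
  then show ?thesis
    by (simp add: haf_def)
qed

text \<open>The matchings are sorted by the partner \<open>j\<close> of \<open>a\<close>; removing
  the edge \<open>{a, j}\<close> leaves a perfect matching of the other vertices.\<close>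

lemma perfect_matchings_expand:
  assumes "a \<notin> V"
  shows "perfect_matchings (insert a V) = (\<Union>j\<in>V. insert {a, j} ` perfect_matchings (V - {j}))"
proof (intro equalityI subsetI)
  fix M assume M: "M \<in> perfect_matchings (insert a V)"
  then have U: "\<Union>M = insert a V" and D: "disjoint M" and E: "{} \<notin> M"
    and C: "\<And>e. e \<in> M \<Longrightarrow> card e = 2"
    by (auto simp: perfect_matchings_def partition_on_def)
  from U obtain e where e: "e \<in> M" "a \<in> e"
    by blast
  from C[OF e(1)] e(2) obtain j where j: "e = {a, j}" "j \<noteq> a"
    unfolding card_2_iff by auto
  have jV: "j \<in> V"
    using U e j by blast
  have "\<Union>(M - {e}) = \<Union>M - e"
    using D e(1) unfolding disjoint_def by fastforce
  also have "\<dots> = V - {j}"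
    unfolding U j using assms by auto
  finally have "\<Union>(M - {e}) = V - {j}" .
  then have "M - {e} \<in> perfect_matchings (V - {j})"
    using D E C by (auto simp: perfect_matchings_def partition_on_def disjoint_def)
  moreover have "M = insert {a, j} (M - {e})"
    using e j by auto
  ultimately show "M \<in> (\<Union>j\<in>V. insert {a, j} ` perfect_matchings (V - {j}))"
    using jV by blast
next
  fix M assume "M \<in> (\<Union>j\<in>V. insert {a, j} ` perfect_matchings (V - {j}))"
  then obtain j M' where j: "j \<in> V" and M': "M' \<in> perfect_matchings (V - {j})"
    and M: "M = insert {a, j} M'"
    by blast
  have "card {a, j} = 2"
    using j assms by (cases "a = j") auto
  moreover have "e \<inter> {a, j} = {}" if "e \<in> M'" for e
    using that M' assms by (auto simp: perfect_matchings_def partition_on_def)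
  moreover have "\<Union>M' = V - {j}" "disjoint M'" "{} \<notin> M'" "\<forall>e\<in>M'. card e = 2"
    using M' by (auto simp: perfect_matchings_def partition_on_def)
  ultimately show "M \<in> perfect_matchings (insert a V)"
    unfolding M perfect_matchings_def partition_on_def mem_Collect_eq pairwise_insert
    using j by (intro conjI) (auto simp: disjnt_def Int_commute)
qed

lemma haf_expand:
  assumes [simp]: "finite V" and a: "a \<notin> V"
  shows "haf (insert a V) x = (\<Sum>j\<in>V. x {a, j} * haf (V - {j}) x)"
proof -
  \<comment> \<open>No matching of the remaining vertices contains an edge at \<open>a\<close>.
    Hence different partners give disjoint families, and inserting \<open>{a, j}\<close> is
    injective.\<close>
  have notin: "{a, i} \<notin> M" if "M \<in> perfect_matchings (V - {j})" for i j M
    using that a by (auto simp: perfect_matchings_def partition_on_def)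
  have disj: "insert {a, i} ` perfect_matchings (V - {i}) \<inter> insert {a, j} ` perfect_matchings (V - {j}) = {}"
    if "i \<noteq> j" for i j
    using that notin by (auto simp: doubleton_eq_iff dest!: equalityD1)
  have "haf (insert a V) x =
      (\<Sum>j\<in>V. \<Sum>M\<in>insert {a, j} ` perfect_matchings (V - {j}). \<Prod>e\<in>M. x e)"
    unfolding haf_def perfect_matchings_expand[OF a]
    using disj by (intro sum.UNION_disjoint) (auto simp: finite_perfect_matchings)
  also have "\<dots> = (\<Sum>j\<in>V. x {a, j} * haf (V - {j}) x)"
  proof (intro sum.cong refl)
    fix j
    have inj: "inj_on (insert {a, j}) (perfect_matchings (V - {j}))"
      using notin by (intro inj_onI) (metis insert_ident)
    have fin: "finite M" if "M \<in> perfect_matchings (V - {j})" for M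
      using perfect_matchings_subset_edges[OF that] by (rule finite_subset) simp
    show "(\<Sum>M\<in>insert {a, j} ` perfect_matchings (V - {j}). \<Prod>e\<in>M. x e) = x {a, j} * haf (V - {j}) x"
      unfolding sum.reindex[OF inj] haf_def sum_distrib_left
      using notin fin by (intro sum.cong refl) simp
  qed
  finally show ?thesis .
qed

lemma measurable_haf [measurable]:
  assumes "V \<subseteq> W"
  shows "haf V \<in> borel_measurable (gauss_vec (edges W))"
  unfolding haf_def
  using perfect_matchings_subset_edges edges_mono[OF assms]
  by (intro borel_measurable_sum borel_measurable_prod) (measurable, blast)

text \<open>Assembles edge weights on \<open>insert a W\<close> from weights \<open>x\<close> on
  \<open>W\<close> and the row \<open>u\<close> of the new vertex. For an edge at \<open>a\<close>,
  \<open>the_elem (e - {a})\<close> is its other endpoint. The restriction to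
  \<open>edges (insert a W)\<close> keeps the result in the extensional space of the product
  measure.\<close>

definition star_ext :: "'a \<Rightarrow> 'a set \<Rightarrow> ('a set \<Rightarrow> complex) \<Rightarrow> ('a \<Rightarrow> complex) \<Rightarrow> 'a set \<Rightarrow> complex" where
  "star_ext a W x u = (\<lambda>e\<in>edges (insert a W). if a \<in> e then u (the_elem (e - {a})) else x e)"

lemma edges_insert:
  assumes "a \<notin> W"
  shows "edges (insert a W) = edges W \<union> (\<lambda>j. {a, j}) ` W"
proof (intro equalityI subsetI)
  fix e assume e: "e \<in> edges (insert a W)"
  show "e \<in> edges W \<union> (\<lambda>j. {a, j}) ` W"
  proof (cases "a \<in> e")
    case True
    with e obtain j where "e = {a, j}" "j \<noteq> a"
      unfolding edges_def card_2_iff by auto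
    with e show ?thesis
      by (auto simp: edges_def)
  qed (use e in \<open>auto simp: edges_def\<close>)
next
  fix e assume e: "e \<in> edges W \<union> (\<lambda>j. {a, j}) ` W"
  have "card {a, j} = 2" if "j \<in> W" for j
    using that assms by (cases "a = j") auto
  with e show "e \<in> edges (insert a W)"
    by (auto simp: edges_def)
qed

lemma star_ext_star [simp]: "a \<notin> W \<Longrightarrow> j \<in> W \<Longrightarrow> star_ext a W x u {a, j} = u j"
  by (auto simp: star_ext_def edges_insert insert_Diff_if)

lemma star_ext_edge [simp]: "a \<notin> W \<Longrightarrow> e \<in> edges W \<Longrightarrow> star_ext a W x u e = x e"
  by (auto simp: star_ext_def edges_insert edges_def)

lemma haf_star_ext: "a \<notin> W \<Longrightarrow> V \<subseteq> W \<Longrightarrow> haf V (star_ext a W x u) = haf V x"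
  using edges_mono by (intro haf_cong star_ext_edge) auto

lemma haf_insert_star_ext:
  assumes "finite W" "a \<notin> W" "V \<subseteq> W"
  shows "haf (insert a V) (star_ext a W x u) = (\<Sum>j\<in>V. u j * haf (V - {j}) x)"
proof -
  have "finite V"
    using assms finite_subset by blast
  moreover have "haf (V - {j}) (star_ext a W x u) = haf (V - {j}) x" for j
    using assms by (intro haf_star_ext) auto
  ultimately show ?thesis
    using assms by (subst haf_expand) (auto intro!: sum.cong simp: subset_eq)
qed

lemma measurable_star_ext [measurable]:
  assumes "a \<notin> W"
  shows "(\<lambda>p. star_ext a W (fst p) (snd p)) \<in>
    measurable (gauss_vec (edges W) \<Otimes>\<^sub>M gauss_vec W) (gauss_vec (edges (insert a W)))"
  unfolding star_ext_def
proof (rule measurable_restrict)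
  fix e assume "e \<in> edges (insert a W)"
  then consider "e \<in> edges W" | j where "j \<in> W" "e = {a, j}"
    by (auto simp: edges_insert[OF assms])
  then show "(\<lambda>p. if a \<in> e then snd p (the_elem (e - {a})) else fst p e)
      \<in> measurable (gauss_vec (edges W) \<Otimes>\<^sub>M gauss_vec W) cgauss"
  proof cases
    case 1
    then have "a \<notin> e" using assms by (auto simp: edges_def)
    with 1 show ?thesis by simp
  next
    case 2
    then have "e - {a} = {j}" using assms by auto
    with 2 show ?thesis by simp
  qed
qed

text \<open>The edges of \<open>insert a W\<close> are the disjoint union of the edges of
  \<open>W\<close> and the star of \<open>a\<close>. On a box both measures are therefore the
  product of the same factors, and boxes determine a product measure.\<close>

lemma distr_star_ext:
  assumes [simp]: "finite W" and a: "a \<notin> W"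
  shows "distr (gauss_vec (edges W) \<Otimes>\<^sub>M gauss_vec W) (gauss_vec (edges (insert a W)))
      (\<lambda>p. star_ext a W (fst p) (snd p)) = gauss_vec (edges (insert a W))"
proof -
  interpret product_prob_space "\<lambda>_. cgauss" "edges (insert a W)" ..
  interpret W: finite_product_prob_space "\<lambda>_. cgauss" W by standard simp
  interpret E: finite_product_prob_space "\<lambda>_. cgauss" "edges W" by standard simp
  show ?thesis
  proof (rule PiM_eqI)
    fix A assume A: "\<And>e. e \<in> edges (insert a W) \<Longrightarrow> A e \<in> sets cgauss"
    have AE: "Pi\<^sub>E (edges W) A \<in> sets (gauss_vec (edges W))"
      using A by (intro sets_PiM_I_finite) (auto simp: edges_insert[OF a])
    have AW: "Pi\<^sub>E W (\<lambda>j. A {a, j}) \<in> sets (gauss_vec W)"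
      using A by (intro sets_PiM_I_finite) (auto simp: edges_insert[OF a])
    have inj: "inj_on (\<lambda>j. {a, j}) W"
      by (auto simp: inj_on_def doubleton_eq_iff)
    have disj: "edges W \<inter> (\<lambda>j. {a, j}) ` W = {}"
      using a by (auto simp: edges_def)
    have ext: "star_ext a W x u \<in> Pi\<^sub>E (edges (insert a W)) A \<longleftrightarrow>
        (\<forall>e\<in>edges W. x e \<in> A e) \<and> (\<forall>j\<in>W. u j \<in> A {a, j})" for x u
    proof -
      have "star_ext a W x u \<in> Pi\<^sub>E (edges (insert a W)) A \<longleftrightarrow>
          (\<forall>e\<in>edges (insert a W). star_ext a W x u e \<in> A e)"
        by (auto simp: PiE_iff star_ext_def)
      also have "\<dots> \<longleftrightarrow> (\<forall>e\<in>edges W. x e \<in> A e) \<and> (\<forall>j\<in>W. u j \<in> A {a, j})"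
        unfolding edges_insert[OF a] ball_Un using a by simp
      finally show ?thesis .
    qed
    have vim: "(\<lambda>p. star_ext a W (fst p) (snd p)) -` Pi\<^sub>E (edges (insert a W)) A \<inter>
        space (gauss_vec (edges W) \<Otimes>\<^sub>M gauss_vec W) = Pi\<^sub>E (edges W) A \<times> Pi\<^sub>E W (\<lambda>j. A {a, j})"
      using ext by (auto simp: space_pair_measure space_PiM PiE_iff)
    have "emeasure (distr (gauss_vec (edges W) \<Otimes>\<^sub>M gauss_vec W) (gauss_vec (edges (insert a W)))
        (\<lambda>p. star_ext a W (fst p) (snd p))) (Pi\<^sub>E (edges (insert a W)) A) =
        emeasure (gauss_vec (edges W) \<Otimes>\<^sub>M gauss_vec W) (Pi\<^sub>E (edges W) A \<times> Pi\<^sub>E W (\<lambda>j. A {a, j}))"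
      using A by (subst emeasure_distr) (auto simp: vim a intro!: sets_PiM_I_finite measurable_star_ext)
    also have "\<dots> = emeasure (gauss_vec (edges W)) (Pi\<^sub>E (edges W) A) *
        emeasure (gauss_vec W) (Pi\<^sub>E W (\<lambda>j. A {a, j}))"
      by (rule gauss_vec.emeasure_pair_measure_Times[OF AE AW])
    also have "\<dots> = (\<Prod>e\<in>edges W. emeasure cgauss (A e)) * (\<Prod>j\<in>W. emeasure cgauss (A {a, j}))"
      using A by (subst E.measure_times, force simp: edges_insert[OF a],
        subst W.measure_times) (auto simp: edges_insert[OF a])
    also have "\<dots> = (\<Prod>e\<in>edges (insert a W). emeasure cgauss (A e))"
      unfolding edges_insert[OF a]
      by (subst prod.union_disjoint) (auto simp: disj prod.reindex[OF inj])
    finally show "emeasure (distr (gauss_vec (edges W) \<Otimes>\<^sub>M gauss_vec W) (gauss_vec (edges (insert a W)))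
        (\<lambda>p. star_ext a W (fst p) (snd p))) (Pi\<^sub>E (edges (insert a W)) A) =
        (\<Prod>e\<in>edges (insert a W). emeasure cgauss (A e))" .
  qed auto
qed

lemma integral_star_ext:
  fixes F :: "_ \<Rightarrow> _::{banach, second_countable_topology}"
  assumes "finite W" "a \<notin> W"
    and F: "F \<in> borel_measurable (gauss_vec (edges (insert a W)))" and B: "\<And>x. norm (F x) \<le> B"
  shows "(\<integral>x. F x \<partial>gauss_vec (edges (insert a W))) =
    (\<integral>x. \<integral>u. F (star_ext a W x u) \<partial>gauss_vec W \<partial>gauss_vec (edges W))"
proof -
  note [measurable] = measurable_star_ext[OF assms(2)] F
  have "(\<integral>x. F x \<partial>gauss_vec (edges (insert a W))) =
      (\<integral>p. F (star_ext a W (fst p) (snd p)) \<partial>(gauss_vec (edges W) \<Otimes>\<^sub>M gauss_vec W))"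
    by (subst distr_star_ext[OF assms(1,2), symmetric], rule integral_distr) measurable
  also have "\<dots> = (\<integral>x. \<integral>u. F (star_ext a W x u) \<partial>gauss_vec W \<partial>gauss_vec (edges W))"
    by (subst gauss_vec2.integral_fst'[symmetric])
       (auto intro!: gauss_vec2.P.integrable_const_bound[where B = B] B)
  finally show ?thesis .
qed

section \<open>Merging two coordinates\<close>

text \<open>The coefficient of \<open>y m * z i\<close> in the bilinear form Q: the vertex
  \<open>k\<close> is matched with \<open>m\<close>, the vertex \<open>l\<close> with
  \<open>i\<close>, and \<open>j\<close> is the vertex deleted in the cofactor. Terms with
  coinciding vertices are set to 0 so that all sums run over \<open>R\<close>.\<close>

definition triple_coeff :: "'a set \<Rightarrow> ('a \<Rightarrow> complex) \<Rightarrow> ('a set \<Rightarrow> complex) \<Rightarrow> 'a \<Rightarrow> 'a \<Rightarrow> complex" where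
  "triple_coeff R u x m i =
     (\<Sum>j\<in>R. if i \<noteq> j \<and> m \<noteq> j \<and> m \<noteq> i then u j * haf (R - {j} - {i} - {m}) x else 0)"

text \<open>The characteristic function of the random cofactor vector on \<open>W\<close>, evaluated
  at \<open>u\<close>.\<close>

definition cofactor_char :: "'a set \<Rightarrow> ('a \<Rightarrow> complex) \<Rightarrow> complex" where
  "cofactor_char W u = (\<integral>x. iexp (Re (\<Sum>j\<in>W. u j * haf (W - {j}) x)) \<partial>gauss_vec (edges W))"

lemma symmetric_form_triple_coeff:
  "finite R \<Longrightarrow> symmetric_form R (triple_coeff R u x)"
proof
  fix m i
  have "R - {j} - {i} - {m} = R - {j} - {m} - {i}" for j
    by blast
  then show "triple_coeff R u x m i = triple_coeff R u x i m"
    unfolding triple_coeff_def by (intro sum.cong refl) auto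
qed

text \<open>Here \<open>y\<close> is the row of \<open>k\<close>, \<open>z\<close> the row of
  \<open>l\<close> towards \<open>R\<close>, and \<open>c\<close> the weight of
  \<open>{k, l}\<close>. Deleting \<open>k\<close> or \<open>l\<close> leaves a hafnian linear in
  the other row. Deleting a vertex of \<open>R\<close> leaves both rows, which contribute
  bilinearly, plus a term in which \<open>k\<close> and \<open>l\<close> are matched with each
  other.\<close>

lemma cofactor_sum_two_stars:
  fixes x :: "'a set \<Rightarrow> complex" and y z u :: "'a \<Rightarrow> complex" and c :: complex
  assumes [simp]: "finite R" and k: "k \<notin> R" and l: "l \<notin> insert k R"
  defines "X \<equiv> star_ext l (insert k R) (star_ext k R x y) (z(k := c))"
    and "W \<equiv> insert l (insert k R)"
  shows "(\<Sum>j\<in>W. u j * haf (W - {j}) X) =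
    (u k * (\<Sum>j\<in>R. haf (R - {j}) x * z j) + u l * (\<Sum>j\<in>R. haf (R - {j}) x * y j) +
      (\<Sum>i\<in>R. (\<Sum>m\<in>R. triple_coeff R u x m i * y m) * z i)) +
    (\<Sum>j\<in>R. u j * haf (R - {j}) x) * c"
proof -
  have W: "W - {l} = insert k R" "W - {k} = insert l R"
    using k l by (auto simp: W_def)
  have 1: "haf (W - {l}) X = (\<Sum>j\<in>R. haf (R - {j}) x * y j)"
    unfolding W X_def using k l by (simp add: haf_star_ext haf_insert_star_ext mult.commute)
  have 2: "haf (W - {k}) X = (\<Sum>j\<in>R. haf (R - {j}) x * z j)"
  proof -
    have "haf (R - {j}) (star_ext k R x y) = haf (R - {j}) x" for j
      using k by (intro haf_star_ext) auto
    then have "haf (W - {k}) X = (\<Sum>j\<in>R. (z(k := c)) j * haf (R - {j}) x)"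
      unfolding W X_def using l by (subst haf_insert_star_ext) auto
    also have "\<dots> = (\<Sum>j\<in>R. haf (R - {j}) x * z j)"
      using k by (intro sum.cong) auto
    finally show ?thesis .
  qed
  \<comment> \<open>First \<open>l\<close> is matched: either with \<open>k\<close>, contributing
    \<open>c\<close>, or with some \<open>i\<close>, after which \<open>k\<close> is matched with
    some \<open>m\<close>.\<close>
  have 3: "haf (W - {j}) X = c * haf (R - {j}) x +
      (\<Sum>i\<in>R. \<Sum>m\<in>R. if i \<noteq> j \<and> m \<noteq> j \<and> m \<noteq> i then z i * (y m * haf (R - {j} - {i} - {m}) x) else 0)"
    if j: "j \<in> R" for j
  proof -
    let ?V = "insert k (R - {j})"
    have "W - {j} = insert l ?V"
      using j k l by (auto simp: W_def)
    then have "haf (W - {j}) X = (\<Sum>i\<in>?V. (z(k := c)) i * haf (?V - {i}) (star_ext k R x y))"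
      unfolding X_def using l by (simp only:, subst haf_insert_star_ext) auto
    also have "\<dots> = c * haf (R - {j}) x +
        (\<Sum>i\<in>R - {j}. (z(k := c)) i * haf (?V - {i}) (star_ext k R x y))"
    proof -
      have "haf (R - {j}) (star_ext k R x y) = haf (R - {j}) x"
        using k by (intro haf_star_ext) auto
      moreover have "?V - {k} = R - {j}"
        using k by auto
      ultimately show ?thesis
        using k by (subst sum.insert) auto
    qed
    also have "(\<Sum>i\<in>R - {j}. (z(k := c)) i * haf (?V - {i}) (star_ext k R x y)) =
        (\<Sum>i\<in>R - {j}. \<Sum>m\<in>R. if i \<noteq> j \<and> m \<noteq> j \<and> m \<noteq> i then z i * (y m * haf (R - {j} - {i} - {m}) x) else 0)"
    proof (intro sum.cong refl)
      fix i assume i: "i \<in> R - {j}"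
      have "?V - {i} = insert k (R - {j} - {i})"
        using i k by auto
      then have "haf (?V - {i}) (star_ext k R x y) = (\<Sum>m\<in>R - {j} - {i}. y m * haf (R - {j} - {i} - {m}) x)"
        using k by (simp only:, intro haf_insert_star_ext) auto
      then have "(z(k := c)) i * haf (?V - {i}) (star_ext k R x y) =
          (\<Sum>m\<in>R - {j} - {i}. z i * (y m * haf (R - {j} - {i} - {m}) x))"
        using i k by (auto simp: sum_distrib_left)
      also have "\<dots> = (\<Sum>m\<in>R. if i \<noteq> j \<and> m \<noteq> j \<and> m \<noteq> i then z i * (y m * haf (R - {j} - {i} - {m}) x) else 0)"
        using i by (intro sum.mono_neutral_cong_left) auto
      finally show "(z(k := c)) i * haf (?V - {i}) (star_ext k R x y) =
        (\<Sum>m\<in>R. if i \<noteq> j \<and> m \<noteq> j \<and> m \<noteq> i then z i * (y m * haf (R - {j} - {i} - {m}) x) else 0)" .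
    qed
    also have "\<dots> = (\<Sum>i\<in>R. \<Sum>m\<in>R. if i \<noteq> j \<and> m \<noteq> j \<and> m \<noteq> i then z i * (y m * haf (R - {j} - {i} - {m}) x) else 0)"
      by (intro sum.mono_neutral_left) auto
    finally show ?thesis .
  qed
  have "(\<Sum>j\<in>W. u j * haf (W - {j}) X) =
      u l * haf (W - {l}) X + (u k * haf (W - {k}) X + (\<Sum>j\<in>R. u j * haf (W - {j}) X))"
    using k l by (subst W_def) simp
  also have "(\<Sum>j\<in>R. u j * haf (W - {j}) X) = (\<Sum>j\<in>R. u j * haf (R - {j}) x) * c +
    (\<Sum>j\<in>R. \<Sum>i\<in>R. \<Sum>m\<in>R. if i \<noteq> j \<and> m \<noteq> j \<and> m \<noteq> i then u j * (z i * (y m * haf (R - {j} - {i} - {m}) x)) else 0)"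
    by (simp add: 3 sum.distrib ring_distribs sum_distrib_left sum_distrib_right mult_ac
        if_distrib[of "\<lambda>x. _ * x"] cong: if_cong)
  also have "(\<Sum>j\<in>R. \<Sum>i\<in>R. \<Sum>m\<in>R. if i \<noteq> j \<and> m \<noteq> j \<and> m \<noteq> i then u j * (z i * (y m * haf (R - {j} - {i} - {m}) x)) else 0) =
     (\<Sum>i\<in>R. \<Sum>m\<in>R. \<Sum>j\<in>R. if i \<noteq> j \<and> m \<noteq> j \<and> m \<noteq> i then u j * (z i * (y m * haf (R - {j} - {i} - {m}) x)) else 0)"
    \<comment> \<open>Moving the sum over the deleted vertex \<open>j\<close> innermost exposes
      \<open>triple_coeff\<close>.\<close>
    by (subst sum.swap, intro sum.cong refl sum.swap)
  also have "\<dots> = (\<Sum>i\<in>R. (\<Sum>m\<in>R. triple_coeff R u x m i * y m) * z i)"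
    unfolding triple_coeff_def sum_distrib_right
    by (intro sum.cong refl) (auto simp: mult_ac)
  finally show ?thesis
    by (simp add: 1 2 algebra_simps)
qed

text \<open>The rows of \<open>k\<close> and \<open>l\<close> are integrated out for fixed weights
  \<open>x\<close> on \<open>R\<close>. The weight of \<open>{k, l}\<close> enters the exponent only
  through a separate linear term, whose average is the explicit Gaussian factor; the rest is
  \<open>osc\<close>.\<close>

lemma cofactor_char_eq_osc:
  assumes [simp]: "finite R" and k: "k \<notin> R" and l: "l \<notin> insert k R"
  shows "cofactor_char (insert l (insert k R)) u =
    (\<integral>x. of_real (exp (- (cmod (\<Sum>j\<in>R. u j * haf (R - {j}) x))\<^sup>2 / 4)) *
      symmetric_form.osc R (\<lambda>j. haf (R - {j}) x) (triple_coeff R u x) (u k) (u l) \<partial>gauss_vec (edges R))"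
proof -
  interpret product_prob_space "\<lambda>_. cgauss" R ..
  let ?W = "insert l (insert k R)"
  let ?F = "\<lambda>X. iexp (Re (\<Sum>j\<in>?W. u j * haf (?W - {j}) X))"
  have F: "?F \<in> borel_measurable (gauss_vec (edges ?W))"
    by measurable
  note ext [measurable] = measurable_star_ext[OF k] measurable_star_ext[OF l]
  have F1: "(\<lambda>X. \<integral>z. ?F (star_ext l (insert k R) X z) \<partial>gauss_vec (insert k R)) \<in>
      borel_measurable (gauss_vec (edges (insert k R)))"
    using measurable_compose[OF ext(2) F] by (intro gauss_vec.borel_measurable_lebesgue_integral) (simp add: split_def)
  have F2: "norm (\<integral>z. ?F (star_ext l (insert k R) X z) \<partial>gauss_vec (insert k R)) \<le> 1" for X
    by (rule order_trans[OF integral_norm_bound]) simp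
  have "cofactor_char ?W u = (\<integral>X. \<integral>z. ?F (star_ext l (insert k R) X z) \<partial>gauss_vec (insert k R)
      \<partial>gauss_vec (edges (insert k R)))"
    unfolding cofactor_char_def using l F by (intro integral_star_ext[where B = 1]) auto
  also have "\<dots> = (\<integral>x. \<integral>y. \<integral>z. ?F (star_ext l (insert k R) (star_ext k R x y) z)
      \<partial>gauss_vec (insert k R) \<partial>gauss_vec R \<partial>gauss_vec (edges R))"
    using k F1 F2 by (intro integral_star_ext[where B = 1]) auto
  also have "\<dots> = (\<integral>x. of_real (exp (- (cmod (\<Sum>j\<in>R. u j * haf (R - {j}) x))\<^sup>2 / 4)) *
      symmetric_form.osc R (\<lambda>j. haf (R - {j}) x) (triple_coeff R u x) (u k) (u l) \<partial>gauss_vec (edges R))"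
  proof (intro Bochner_Integration.integral_cong refl)
    fix x assume x: "x \<in> space (gauss_vec (edges R))"
    interpret symmetric_form R "\<lambda>j. haf (R - {j}) x" "triple_coeff R u x"
      by (rule symmetric_form_triple_coeff) simp
    let ?\<kappa> = "\<Sum>j\<in>R. u j * haf (R - {j}) x"
    let ?E = "complex_of_real (exp (- (cmod ?\<kappa>)\<^sup>2 / 4))"
    have inner: "(\<integral>z. ?F (star_ext l (insert k R) (star_ext k R x y) z) \<partial>gauss_vec (insert k R)) =
        ?E * (\<integral>z. iexp (Re (u k * lin z + u l * lin y + (\<Sum>j\<in>R. row y j * z j))) \<partial>gauss_vec R)"
      if y: "y \<in> space (gauss_vec R)" for y
    proof -
      have "star_ext k R x y \<in> space (gauss_vec (edges (insert k R)))"
        using measurable_space[OF ext(1), of "(x, y)"] x y by (simp add: space_pair_measure)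
      then have "(\<lambda>z. (star_ext k R x y, z)) \<in> measurable (gauss_vec (insert k R))
          (gauss_vec (edges (insert k R)) \<Otimes>\<^sub>M gauss_vec (insert k R))"
        by simp
      from measurable_compose[OF measurable_compose[OF this ext(2)] F]
      have "integrable (gauss_vec (insert k R)) (\<lambda>z. ?F (star_ext l (insert k R) (star_ext k R x y) z))"
        by (intro gauss_vec.integrable_const_bound[where B = 1]) auto
      then have "(\<integral>z. ?F (star_ext l (insert k R) (star_ext k R x y) z) \<partial>gauss_vec (insert k R)) =
          (\<integral>z. \<integral>c. ?F (star_ext l (insert k R) (star_ext k R x y) (z(k := c))) \<partial>cgauss \<partial>gauss_vec R)"
        \<comment> \<open>Coordinate \<open>k\<close> of the row of \<open>l\<close> is the weight
          of \<open>{k, l}\<close>; it is split off and integrated innermost.\<close>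
        using k by (intro product_integral_insert) auto
      also have "\<dots> = (\<integral>z. \<integral>c. iexp (Re (u k * lin z + u l * lin y + (\<Sum>j\<in>R. row y j * z j))) *
          iexp (Re (?\<kappa> * c)) \<partial>cgauss \<partial>gauss_vec R)"
        unfolding cofactor_sum_two_stars[OF assms] lin_def row_def
        by (simp only: plus_complex.simps of_real_add ring_distribs exp_add)
      also have "\<dots> = (\<integral>z. ?E * iexp (Re (u k * lin z + u l * lin y + (\<Sum>j\<in>R. row y j * z j))) \<partial>gauss_vec R)"
        by (simp only: integral_mult_right_zero integral_mult_left_zero char_cgauss exp_of_real)
          (rule mult.commute)
      also have "\<dots> = ?E * (\<integral>z. iexp (Re (u k * lin z + u l * lin y + (\<Sum>j\<in>R. row y j * z j))) \<partial>gauss_vec R)"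
        by (rule integral_mult_right_zero)
      finally show ?thesis .
    qed
    have "(\<integral>y. \<integral>z. ?F (star_ext l (insert k R) (star_ext k R x y) z) \<partial>gauss_vec (insert k R) \<partial>gauss_vec R) =
        (\<integral>y. ?E * (\<integral>z. iexp (Re (u k * lin z + u l * lin y + (\<Sum>j\<in>R. row y j * z j))) \<partial>gauss_vec R) \<partial>gauss_vec R)"
      by (rule Bochner_Integration.integral_cong[OF refl inner])
    also have "\<dots> = ?E * osc (u k) (u l)"
      by (simp only: integral_mult_right_zero osc_eq_iterated)
    finally show "(\<integral>y. \<integral>z. ?F (star_ext l (insert k R) (star_ext k R x y) z) \<partial>gauss_vec (insert k R) \<partial>gauss_vec R) =
        ?E * osc (u k) (u l)" .
  qed
  finally show ?thesis .
qed

text \<open>The Gaussian factor and the bilinear form depend on \<open>u\<close> only through its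
  values on \<open>R\<close>, and \<open>cmod_osc\<close> depends only on the sum of the squared
  moduli of the other two values. Thus merging leaves the modulus of the integrand unchanged for
  every \<open>x\<close>.\<close>

lemma cmod_cofactor_char_merge:
  assumes fin: "finite W" and kl: "k \<in> W" "l \<in> W" "k \<noteq> l"
  shows "cmod (cofactor_char W u) \<le>
    cmod (cofactor_char W (u(k := of_real (sqrt ((cmod (u k))\<^sup>2 + (cmod (u l))\<^sup>2)), l := 0)))"
proof -
  define R where "R = W - {k, l}"
  have R: "finite R" "k \<notin> R" "l \<notin> insert k R" and W: "W = insert l (insert k R)"
    using fin kl by (auto simp: R_def)
  define r where "r = sqrt ((cmod (u k))\<^sup>2 + (cmod (u l))\<^sup>2)"
  define u' where "u' = u(k := of_real r, l := 0)"
  define g where "g x = exp (- (cmod (\<Sum>j\<in>R. u j * haf (R - {j}) x))\<^sup>2 / 4) *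
    symmetric_form.mass R (\<lambda>j. haf (R - {j}) x) (triple_coeff R u x) (of_real r)" for x
  have g: "0 \<le> g x" for x
    unfolding g_def using symmetric_form.mass_nonneg[OF symmetric_form_triple_coeff[OF R(1)]] by simp
  have "cmod (cofactor_char W u) \<le> (\<integral>x. g x \<partial>gauss_vec (edges R))"
    unfolding W cofactor_char_eq_osc[OF R] g_def
    by (rule order_trans[OF integral_norm_bound])
       (simp add: norm_mult symmetric_form.cmod_osc[OF symmetric_form_triple_coeff[OF R(1)]] r_def)
  \<comment> \<open>At the merged vector the integrand is a nonnegative \<open>mass\<close>, so here
    the triangle inequality over \<open>x\<close> is an equality.\<close>
  moreover have "cofactor_char W u' = of_real (\<integral>x. g x \<partial>gauss_vec (edges R))"
  proof -
    have "u' j = u j" if "j \<in> R" for j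
      using that R by (auto simp: u'_def)
    then have "(\<Sum>j\<in>R. u' j * haf (R - {j}) x) = (\<Sum>j\<in>R. u j * haf (R - {j}) x)"
      "triple_coeff R u' x = triple_coeff R u x" for x
      by (auto simp: triple_coeff_def fun_eq_iff intro!: sum.cong)
    moreover have "u' k = of_real r" "u' l = 0"
      using kl by (auto simp: u'_def)
    ultimately show ?thesis
      unfolding W cofactor_char_eq_osc[OF R] g_def integral_complex_of_real[symmetric]
      by (simp add: symmetric_form.osc_eq_mass[OF symmetric_form_triple_coeff[OF R(1)]])
  qed
  then have "cmod (cofactor_char W u') = (\<integral>x. g x \<partial>gauss_vec (edges R))"
    using g by (simp add: Bochner_Integration.integral_nonneg)
  ultimately show ?thesis
    by (simp add: u'_def r_def)
qed

section \<open>Laplace transforms of the cofactor norm\<close>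

lemma cofactor_char_cong:
  assumes "\<And>j. j \<in> W \<Longrightarrow> u j = v j"
  shows "cofactor_char W u = cofactor_char W v"
  unfolding cofactor_char_def using assms by (simp cong: sum.cong)

text \<open>\<open>S\<close> is the set of coordinates already emptied into \<open>k\<close>; each
  induction step merges one more of them.\<close>

lemma cmod_cofactor_char_concentrate_on:
  assumes W: "finite W" "k \<in> W" and S: "finite S" "S \<noteq> {}" "S \<subseteq> W - {k}"
  shows "cmod (cofactor_char W u) \<le> cmod (cofactor_char W
    (\<lambda>j. if j \<in> S then 0 else if j = k then of_real (sqrt (\<Sum>i\<in>insert k S. (cmod (u i))\<^sup>2)) else u j))"
  using S
proof (induction rule: finite_ne_induct)
  case (singleton l)
  then have "u(k := of_real (sqrt ((cmod (u k))\<^sup>2 + (cmod (u l))\<^sup>2)), l := 0) =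
      (\<lambda>j. if j \<in> {l} then 0 else if j = k then of_real (sqrt (\<Sum>i\<in>{k, l}. (cmod (u i))\<^sup>2)) else u j)"
    by (auto simp: fun_eq_iff)
  with singleton cmod_cofactor_char_merge[OF W, of l u] show ?case
    by auto
next
  case (insert l S)
  let ?v = "\<lambda>j. if j \<in> S then 0 else if j = k then of_real (sqrt (\<Sum>i\<in>insert k S. (cmod (u i))\<^sup>2)) else u j"
  have kl: "l \<noteq> k" "l \<in> W" "k \<notin> S" "l \<notin> S"
    using insert by auto
  have "cmod (cofactor_char W u) \<le> cmod (cofactor_char W ?v)"
    using insert by auto
  also have "\<dots> \<le> cmod (cofactor_char W
      (?v(k := of_real (sqrt ((cmod (?v k))\<^sup>2 + (cmod (?v l))\<^sup>2)), l := 0)))"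
    using kl by (intro cmod_cofactor_char_merge W) auto
  also have "(cmod (?v k))\<^sup>2 + (cmod (?v l))\<^sup>2 = (\<Sum>i\<in>insert k (insert l S). (cmod (u i))\<^sup>2)"
    using kl insert.hyps by (simp add: sum_nonneg)
  also have "?v(k := of_real (sqrt (\<Sum>i\<in>insert k (insert l S). (cmod (u i))\<^sup>2)), l := 0) =
      (\<lambda>j. if j \<in> insert l S then 0 else if j = k
        then of_real (sqrt (\<Sum>i\<in>insert k (insert l S). (cmod (u i))\<^sup>2)) else u j)"
    using kl by (auto simp: fun_eq_iff)
  finally show ?case .
qed

section \<open>The squared cofactor norm and its Laplace transform\<close>

definition cofactor_norm :: "'a set \<Rightarrow> ('a set \<Rightarrow> complex) \<Rightarrow> real" where
  "cofactor_norm W x = (\<Sum>j\<in>W. (cmod (haf (W - {j}) x))\<^sup>2)"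

text \<open>Taken in \<open>ennreal\<close>, so that later exchanges of integrals require
  measurability only. Note that \<open>cofactor_norm\<close> is the square of the Euclidean
  norm.\<close>

definition cofactor_laplace :: "'a set \<Rightarrow> real \<Rightarrow> ennreal" where
  "cofactor_laplace W t = (\<integral>\<^sup>+x. exp (- t * cofactor_norm W x) \<partial>gauss_vec (edges W))"

lemma measurable_cofactor_norm [measurable]:
  "cofactor_norm W \<in> borel_measurable (gauss_vec (edges W))"
  unfolding cofactor_norm_def by measurable

lemma cofactor_norm_nonneg: "0 \<le> cofactor_norm W x"
  by (auto simp: cofactor_norm_def intro!: sum_nonneg)

lemma cofactor_laplace_eq:
  assumes "0 \<le> t"
  shows "cofactor_laplace W t = ennreal (\<integral>x. exp (- t * cofactor_norm W x) \<partial>gauss_vec (edges W))"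
  unfolding cofactor_laplace_def using assms cofactor_norm_nonneg[of W]
  by (intro nn_integral_eq_integral gauss_vec.integrable_const_bound[where B = 1]) auto

text \<open>For \<open>u\<close> supported at \<open>k\<close> only the cofactor
  \<open>haf (insert l W)\<close> remains. Expanded along \<open>l\<close>, it is a linear form in a
  Gaussian row whose coefficients are the cofactors of \<open>W\<close>, and
  \<open>char_gauss_vec\<close> evaluates its average.\<close>

lemma cofactor_char_single:
  assumes [simp]: "finite W" and l: "l \<notin> W" and k: "k \<notin> insert l W"
  shows "cofactor_char (insert k (insert l W)) (\<lambda>j. if j = k then of_real r else 0) =
    of_real (\<integral>x. exp (- (r\<^sup>2 / 4) * cofactor_norm W x) \<partial>gauss_vec (edges W))"
proof -
  let ?F = "\<lambda>x. iexp (Re (of_real r * haf (insert l W) x))"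
  have [measurable]: "?F \<in> borel_measurable (gauss_vec (edges (insert l W)))"
    by measurable
  have W: "insert k (insert l W) - {k} = insert l W"
    using k by auto
  have "cofactor_char (insert k (insert l W)) (\<lambda>j. if j = k then of_real r else 0) =
      (\<integral>x. ?F x \<partial>gauss_vec (edges (insert k (insert l W))))"
  proof -
    have "(\<Sum>j\<in>insert k (insert l W). (if j = k then of_real r else 0) * haf (insert k (insert l W) - {j}) x) =
        of_real r * haf (insert l W) x" for x
    proof -
      have "(\<Sum>j\<in>insert k (insert l W). (if j = k then of_real r else 0) * haf (insert k (insert l W) - {j}) x) =
          (\<Sum>j\<in>insert k (insert l W). if j = k then of_real r * haf (insert l W) x else 0)"
        by (intro sum.cong refl) (simp add: W)
      then show ?thesis
        by (simp only: sum.delta finite_insert assms(1) insertI1 if_True)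
    qed
    then show ?thesis
      by (simp only: cofactor_char_def)
  qed
  also have "\<dots> = (\<integral>x. \<integral>u. ?F (star_ext k (insert l W) x u) \<partial>gauss_vec (insert l W) \<partial>gauss_vec (edges (insert l W)))"
    by (rule integral_star_ext[OF _ k, where B = 1]) (simp, measurable, auto)
  also have "\<dots> = (\<integral>x. ?F x \<partial>gauss_vec (edges (insert l W)))"
    \<comment> \<open>The integrand does not involve the row of \<open>k\<close>, which integrates
      to 1.\<close>
    by (simp add: haf_star_ext[OF k] gauss_vec.prob_space)
  also have "\<dots> = (\<integral>x. \<integral>u. ?F (star_ext l W x u) \<partial>gauss_vec W \<partial>gauss_vec (edges W))"
    by (rule integral_star_ext[OF _ l, where B = 1]) auto
  also have "\<dots> = (\<integral>x. of_real (exp (- (r\<^sup>2 / 4) * cofactor_norm W x)) \<partial>gauss_vec (edges W))"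
  proof (intro Bochner_Integration.integral_cong refl)
    fix x
    have "of_real r * haf (insert l W) (star_ext l W x u) = (\<Sum>j\<in>W. (of_real r * haf (W - {j}) x) * u j)" for u
      using l by (simp add: haf_insert_star_ext sum_distrib_left mult_ac)
    then have "(\<integral>u. ?F (star_ext l W x u) \<partial>gauss_vec W) =
        of_real (exp (- (\<Sum>j\<in>W. (cmod (of_real r * haf (W - {j}) x))\<^sup>2) / 4))"
      by (simp only: char_gauss_vec[OF assms(1)])
    also have "(\<Sum>j\<in>W. (cmod (of_real r * haf (W - {j}) x))\<^sup>2) = r\<^sup>2 * cofactor_norm W x"
      by (simp add: cofactor_norm_def sum_distrib_left norm_mult power_mult_distrib)
    finally show "(\<integral>u. ?F (star_ext l W x u) \<partial>gauss_vec W) = of_real (exp (- (r\<^sup>2 / 4) * cofactor_norm W x))"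
      by simp
  qed
  finally show ?thesis
    by simp
qed

lemma cmod_cofactor_char_le:
  assumes [simp]: "finite W" and l: "l \<notin> W" and k: "k \<notin> insert l W"
  shows "cmod (cofactor_char (insert k (insert l W)) u) \<le>
    (\<integral>x. exp (- ((\<Sum>j\<in>insert k (insert l W). (cmod (u j))\<^sup>2) / 4) * cofactor_norm W x) \<partial>gauss_vec (edges W))"
proof -
  let ?V = "insert k (insert l W)"
  let ?r = "sqrt (\<Sum>i\<in>?V. (cmod (u i))\<^sup>2)"
  have "cmod (cofactor_char ?V u) \<le> cmod (cofactor_char ?V
    (\<lambda>j. if j \<in> insert l W then 0 else if j = k then of_real ?r else u j))"
    using k by (intro cmod_cofactor_char_concentrate_on) auto
  also have "cofactor_char ?V (\<lambda>j. if j \<in> insert l W then 0 else if j = k then of_real ?r else u j) =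
      cofactor_char ?V (\<lambda>j. if j = k then of_real ?r else 0)"
    using k by (intro cofactor_char_cong) auto
  also have "cmod \<dots> = (\<integral>x. exp (- (?r\<^sup>2 / 4) * cofactor_norm W x) \<partial>gauss_vec (edges W))"
    unfolding cofactor_char_single[OF assms] norm_of_real
    by (intro abs_of_nonneg Bochner_Integration.integral_nonneg) simp
  also have "?r\<^sup>2 = (\<Sum>i\<in>?V. (cmod (u i))\<^sup>2)"
    by (intro real_sqrt_pow2 sum_nonneg) simp
  finally show ?thesis .
qed

text \<open>The exponential of the squared norm is rewritten as the average of a phase over an
  independent Gaussian vector \<open>u\<close>. Exchanging the averages produces
  \<open>cofactor_char\<close> at a multiple of \<open>u\<close>, whose modulus is bounded by that
  of the concentrated vector.\<close>

lemma cofactor_laplace_le_gauss: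
  fixes W :: "'a set"
  assumes [simp]: "finite W" and l: "l \<notin> W" and k: "k \<notin> insert l W" and t: "0 \<le> t"
  defines "V \<equiv> insert k (insert l W)"
  shows "cofactor_laplace V t \<le>
    (\<integral>\<^sup>+u. cofactor_laplace W (t * (\<Sum>j\<in>V. (cmod (u j))\<^sup>2)) \<partial>gauss_vec V)"
proof -
  have [simp]: "finite V"
    by (simp add: V_def)
  \<comment> \<open>The characteristic function contributes \<open>s\<^sup>2 / 4\<close>, which has
    to equal \<open>t\<close>.\<close>
  define s where "s = 2 * sqrt t"
  have s2: "s\<^sup>2 = 4 * t"
    using t by (simp add: s_def power_mult_distrib)
  let ?h = "\<lambda>x u. iexp (Re (\<Sum>j\<in>V. (of_real s * u j) * haf (V - {j}) x))"
  let ?g = "\<lambda>u. \<integral>x. exp (- (t * (\<Sum>j\<in>V. (cmod (u j))\<^sup>2)) * cofactor_norm W x) \<partial>gauss_vec (edges W)"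
  have [measurable]: "(\<lambda>p. haf (V - {j}) (fst p)) \<in>
      borel_measurable (gauss_vec (edges V) \<Otimes>\<^sub>M gauss_vec V)" for j
    by (rule measurable_compose[OF measurable_fst measurable_haf]) auto
  have [measurable]: "(\<lambda>p. haf (V - {j}) (snd p)) \<in>
      borel_measurable (gauss_vec V \<Otimes>\<^sub>M gauss_vec (edges V))" for j
    by (rule measurable_compose[OF measurable_snd measurable_haf]) auto
  have [measurable]: "(\<lambda>u. cofactor_char V (\<lambda>j. of_real s * u j)) \<in> borel_measurable (gauss_vec V)"
    unfolding cofactor_char_def by measurable
  have char: "(\<integral>u. ?h x u \<partial>gauss_vec V) = of_real (exp (- t * cofactor_norm V x))" for x
  proof -
    have "(\<integral>u. ?h x u \<partial>gauss_vec V) =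
        (\<integral>u. iexp (Re (\<Sum>j\<in>V. (of_real s * haf (V - {j}) x) * u j)) \<partial>gauss_vec V)"
      by (simp only: mult_ac)
    also have "\<dots> = of_real (exp (- (\<Sum>j\<in>V. (cmod (of_real s * haf (V - {j}) x))\<^sup>2) / 4))"
      by (rule char_gauss_vec) simp
    also have "(\<Sum>j\<in>V. (cmod (of_real s * haf (V - {j}) x))\<^sup>2) = 4 * t * cofactor_norm V x"
      by (simp add: cofactor_norm_def sum_distrib_left norm_mult power_mult_distrib s2)
    finally show ?thesis by simp
  qed
  have "complex_of_real (\<integral>x. exp (- t * cofactor_norm V x) \<partial>gauss_vec (edges V)) =
      (\<integral>x. \<integral>u. ?h x u \<partial>gauss_vec V \<partial>gauss_vec (edges V))"
    by (simp only: char integral_complex_of_real)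
  also have "\<dots> = (\<integral>u. \<integral>x. ?h x u \<partial>gauss_vec (edges V) \<partial>gauss_vec V)"
    by (rule gauss_vec2.Fubini_integral[symmetric])
       (rule gauss_vec2.P.integrable_const_bound[where B = 1],
        simp only: split_beta norm_exp_i_times, simp, measurable)
  also have "\<dots> = (\<integral>u. cofactor_char V (\<lambda>j. of_real s * u j) \<partial>gauss_vec V)"
    by (simp only: cofactor_char_def)
  finally have eq: "complex_of_real (\<integral>x. exp (- t * cofactor_norm V x) \<partial>gauss_vec (edges V)) =
      (\<integral>u. cofactor_char V (\<lambda>j. of_real s * u j) \<partial>gauss_vec V)" .
  have g1: "norm (?g u) \<le> 1" for u
  proof -
    have "\<bar>exp (- (t * (\<Sum>j\<in>V. (cmod (u j))\<^sup>2)) * cofactor_norm W x)\<bar> \<le> 1" for x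
      using t cofactor_norm_nonneg[of W x] by (simp add: sum_nonneg)
    then show ?thesis
      by (intro gauss_vec.integral_le_const order_trans[OF integral_norm_bound] gauss_vec.integrable_const_bound[where B = 1]) auto
  qed
  have g_int: "integrable (gauss_vec V) ?g"
    using g1 by (intro gauss_vec.integrable_const_bound[where B = 1]) auto
  have "(\<integral>x. exp (- t * cofactor_norm V x) \<partial>gauss_vec (edges V)) =
      cmod (\<integral>u. cofactor_char V (\<lambda>j. of_real s * u j) \<partial>gauss_vec V)"
    \<comment> \<open>The left side is nonnegative, hence equal to the modulus of the average of
      \<open>cofactor_char\<close>.\<close>
    unfolding eq[symmetric] norm_of_real
    by (intro abs_of_nonneg[symmetric] Bochner_Integration.integral_nonneg) simp
  also have "\<dots> \<le> (\<integral>u. ?g u \<partial>gauss_vec V)"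
  proof (rule order_trans[OF integral_norm_bound Bochner_Integration.integral_mono[OF _ g_int]])
    have "cmod (cofactor_char V (\<lambda>j. of_real s * u j)) \<le> 1" for u
      unfolding cofactor_char_def by (rule order_trans[OF integral_norm_bound]) (simp add: gauss_vec.prob_space)
    then show "integrable (gauss_vec V) (\<lambda>u. cmod (cofactor_char V (\<lambda>j. of_real s * u j)))"
      by (intro gauss_vec.integrable_const_bound[where B = 1]) auto
    fix u
    show "cmod (cofactor_char V (\<lambda>j. of_real s * u j)) \<le> ?g u"
      using cmod_cofactor_char_le[OF assms(1) l k, of "\<lambda>j. of_real s * u j"]
      by (simp add: V_def[symmetric] norm_mult power_mult_distrib s2 sum_distrib_left[symmetric])
  qed
  finally have "cofactor_laplace V t \<le> ennreal (\<integral>u. ?g u \<partial>gauss_vec V)"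
    unfolding cofactor_laplace_eq[OF t] by (rule ennreal_leI)
  also have "\<dots> = (\<integral>\<^sup>+u. ?g u \<partial>gauss_vec V)"
    by (intro nn_integral_eq_integral[symmetric] g_int AE_I2 Bochner_Integration.integral_nonneg) simp
  also have "\<dots> = (\<integral>\<^sup>+u. cofactor_laplace W (t * (\<Sum>j\<in>V. (cmod (u j))\<^sup>2)) \<partial>gauss_vec V)"
    using t by (intro nn_integral_cong cofactor_laplace_eq[symmetric]) (simp add: sum_nonneg)
  finally show ?thesis .
qed

section \<open>Gamma mixtures\<close>

text \<open>Multiplying the density by \<open>exp (- c * x\<^sup>2)\<close> gives, up to the stated
  constant, the normal density of variance 1 / (2 (1 + c)).\<close>

lemma integral_exp_real_gauss:
  assumes "0 \<le> c"
  shows "(\<integral>x. exp (- c * x\<^sup>2) \<partial>real_gauss) = 1 / sqrt (1 + c)"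
proof -
  have 1: "normal_density 0 (sqrt (1 / 2)) x = 1 / sqrt pi * exp (- x\<^sup>2)" for x
    by (simp add: normal_density_def)
  have 2: "normal_density 0 (sqrt (1 / (2 * (1 + c)))) x = sqrt (1 + c) / sqrt pi * exp (- ((1 + c) * x\<^sup>2))" for x
  proof -
    have "(sqrt (1 / (2 * (1 + c))))\<^sup>2 = 1 / (2 * (1 + c))"
      using assms by (intro real_sqrt_pow2) simp
    moreover have "2 * pi * (1 / (2 * (1 + c))) = pi / (1 + c)"
      "- (x - 0)\<^sup>2 / (2 * (1 / (2 * (1 + c)))) = - ((1 + c) * x\<^sup>2)"
      using assms by (simp_all add: field_simps)
    ultimately show ?thesis
      by (simp only: normal_density_def real_sqrt_divide) simp
  qed
  have "normal_density 0 (sqrt (1 / 2)) x * exp (- c * x\<^sup>2) =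
      1 / sqrt (1 + c) * normal_density 0 (sqrt (1 / (2 * (1 + c)))) x" for x
  proof -
    have "exp (- ((1 + c) * x\<^sup>2)) = exp (- x\<^sup>2) * exp (- c * x\<^sup>2)"
      by (simp add: exp_add[symmetric] algebra_simps)
    then show ?thesis
      unfolding 1 2 using assms by simp
  qed
  then have "(\<integral>x. exp (- c * x\<^sup>2) \<partial>real_gauss) =
      (\<integral>x. 1 / sqrt (1 + c) * normal_density 0 (sqrt (1 / (2 * (1 + c)))) x \<partial>lborel)"
    unfolding real_gauss_def by (subst integral_density) (simp_all only: real_scaleR_def, auto)
  also have "\<dots> = 1 / sqrt (1 + c)"
    using assms by (subst integral_mult_right_zero, subst integral_normal_density) auto
  finally show ?thesis .
qed

lemma integral_exp_cgauss:
  assumes "0 \<le> c"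
  shows "(\<integral>z. exp (- c * (cmod z)\<^sup>2) \<partial>cgauss) = 1 / (1 + c)"
proof -
  have "(\<integral>z. exp (- c * (cmod z)\<^sup>2) \<partial>cgauss) =
      (\<integral>p. exp (- c * (fst p)\<^sup>2) * exp (- c * (snd p)\<^sup>2) \<partial>(real_gauss \<Otimes>\<^sub>M real_gauss))"
    unfolding cgauss_def
    by (subst integral_distr) (auto simp: split_def cmod_power2 exp_add[symmetric] algebra_simps)
  also have "\<dots> = (\<integral>x. exp (- c * x\<^sup>2) \<partial>real_gauss) * (\<integral>x. exp (- c * x\<^sup>2) \<partial>real_gauss)"
    using assms by (intro real_gauss2.integral_mult_fst_snd) auto
  also have "\<dots> = 1 / (1 + c)"
    using assms by (simp add: integral_exp_real_gauss[OF assms, simplified])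
  finally show ?thesis .
qed

text \<open>By independence of the coordinates. The value is the Laplace transform of Gamma(d, 1)
  with \<open>d = card W\<close>.\<close>

lemma integral_exp_gauss_vec:
  assumes "finite W" "0 \<le> c"
  shows "(\<integral>u. exp (- c * (\<Sum>j\<in>W. (cmod (u j))\<^sup>2)) \<partial>gauss_vec W) = (1 / (1 + c)) ^ card W"
proof -
  interpret product_prob_space "\<lambda>_. cgauss" W ..
  have "(\<integral>u. exp (- c * (\<Sum>j\<in>W. (cmod (u j))\<^sup>2)) \<partial>gauss_vec W) =
      (\<integral>u. (\<Prod>j\<in>W. exp (- c * (cmod (u j))\<^sup>2)) \<partial>gauss_vec W)"
    by (simp only: sum_distrib_left exp_sum[OF assms(1)])
  also have "\<dots> = (\<Prod>j\<in>W. \<integral>z. exp (- c * (cmod z)\<^sup>2) \<partial>cgauss)"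
    using assms(2)
    by (intro product_integral_prod[OF assms(1)] cgauss.integrable_const_bound[where B = 1]) auto
  finally show ?thesis
    by (simp only: integral_exp_cgauss[OF assms(2)] prod_constant)
qed

section \<open>Gamma laws with integer parameter\<close>

definition gamma_law :: "nat \<Rightarrow> real measure" where
  "gamma_law d = density lborel (\<lambda>x. ennreal (gamma_density (real d) x))"

lemma measurable_gamma_density [measurable]: "gamma_density r \<in> borel_measurable borel"
  unfolding gamma_density_def[abs_def] by measurable

lemma sets_gamma_law [simp, measurable_cong]: "sets (gamma_law d) = sets borel"
  by (simp add: gamma_law_def)

lemma AE_gamma_law_pos: "AE y in gamma_law d. 0 < y"
  unfolding gamma_law_def by (subst AE_density) (auto simp: gamma_density_def)

text \<open>The tilted Gamma density is a multiple of the Erlang density of rate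
  \<open>1 + c\<close>, whose total mass is 1.\<close>

lemma nn_integral_gamma_law:
  assumes "0 \<le> c" "1 \<le> d"
  shows "(\<integral>\<^sup>+y. exp (- c * y) \<partial>gamma_law d) = ennreal ((1 / (1 + c)) ^ d)"
proof -
  obtain k where d: "d = Suc k"
    using assms(2) by (cases d) auto
  have eq: "gamma_density (real d) y * exp (- c * y) = (1 / (1 + c)) ^ d * erlang_density k (1 + c) y"
    if "y \<noteq> 0" for y
  proof (cases "0 < y")
    case True
    have "Gamma (real d) = fact k"
      using Gamma_fact[of k, where 'a = real] by (simp add: d add.commute)
    moreover have "y powr (real d - 1) = y ^ k"
      using True by (simp add: d powr_realpow)
    moreover have "exp (- y) * exp (- c * y) = exp (- (1 + c) * y)"
      by (simp add: exp_add[symmetric] algebra_simps)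
    moreover have "(1 / (1 + c)) ^ d * (1 + c) ^ Suc k = 1"
      using assms(1) by (simp add: d flip: power_mult_distrib)
    ultimately show ?thesis
      using True by (simp add: gamma_density_def erlang_density_def mult.assoc[symmetric] del: power_Suc)
  qed (use that in \<open>simp add: gamma_density_def erlang_density_def\<close>)
  have nonneg: "0 \<le> gamma_density (real d) y" for y
    using d by (auto simp: gamma_density_def intro!: divide_nonneg_nonneg Gamma_real_nonneg)
  \<comment> \<open>For \<open>d = 1\<close> the two densities differ at 0, where
    \<open>gamma_density\<close> vanishes and \<open>erlang_density\<close> does not.\<close>
  have AE0: "AE y in lborel. y \<noteq> (0::real)"
    by (rule AE_lborel_singleton)
  have "(\<integral>\<^sup>+y. exp (- c * y) \<partial>gamma_law d) =
      (\<integral>\<^sup>+y. ennreal (gamma_density (real d) y * exp (- c * y)) \<partial>lborel)"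
    unfolding gamma_law_def using nonneg by (subst nn_integral_density) (auto simp: ennreal_mult)
  also have "\<dots> = (\<integral>\<^sup>+y. ennreal ((1 / (1 + c)) ^ d) * ennreal (erlang_density k (1 + c) y) \<partial>lborel)"
  proof (intro nn_integral_cong_AE eventually_mono[OF AE0])
    fix y :: real assume "y \<noteq> 0"
    from eq[OF this] show "ennreal (gamma_density (real d) y * exp (- c * y)) =
        ennreal ((1 / (1 + c)) ^ d) * ennreal (erlang_density k (1 + c) y)"
      using assms(1) by (simp only: ennreal_mult[symmetric] zero_le_power zero_le_divide_1_iff erlang_density_nonneg add_nonneg_nonneg zero_le_one)
  qed
  also have "\<dots> = ennreal ((1 / (1 + c)) ^ d) * (\<integral>\<^sup>+y. ennreal (erlang_density k (1 + c) y) \<partial>lborel)"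
    by (rule nn_integral_cmult) measurable
  also have "(\<integral>\<^sup>+y. ennreal (erlang_density k (1 + c) y) \<partial>lborel) = 1"
    using prob_space.emeasure_space_1[OF prob_space_erlang_density[of "1 + c" k]] assms(1)
    by (simp add: emeasure_density)
  finally show ?thesis by simp
qed

lemma prob_space_gamma_law: "1 \<le> d \<Longrightarrow> prob_space (gamma_law d)"
  using nn_integral_gamma_law[of 0 d] by (intro prob_spaceI) simp

lemma nn_integral_cofactor_laplace_gamma:
  assumes "1 \<le> d" "0 \<le> t"
  shows "(\<integral>\<^sup>+y. cofactor_laplace W (t * y) \<partial>gamma_law d) =
    (\<integral>\<^sup>+x. ennreal ((1 / (1 + t * cofactor_norm W x)) ^ d) \<partial>gauss_vec (edges W))"
proof -
  interpret \<Gamma>: prob_space "gamma_law d"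
    by (rule prob_space_gamma_law) fact
  interpret P: pair_prob_space "gauss_vec (edges W)" "gamma_law d" ..
  have "(\<integral>\<^sup>+y. cofactor_laplace W (t * y) \<partial>gamma_law d) =
      (\<integral>\<^sup>+x. \<integral>\<^sup>+y. exp (- (t * y) * cofactor_norm W x) \<partial>gamma_law d \<partial>gauss_vec (edges W))"
    unfolding cofactor_laplace_def by (rule P.Fubini') measurable
  also have "\<dots> = (\<integral>\<^sup>+x. \<integral>\<^sup>+y. exp (- (t * cofactor_norm W x) * y) \<partial>gamma_law d \<partial>gauss_vec (edges W))"
    by (simp add: mult_ac)
  also have "\<dots> = (\<integral>\<^sup>+x. ennreal ((1 / (1 + t * cofactor_norm W x)) ^ d) \<partial>gauss_vec (edges W))"
    using assms cofactor_norm_nonneg by (intro nn_integral_cong nn_integral_gamma_law mult_nonneg_nonneg) auto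
  finally show ?thesis .
qed

text \<open>Once the cofactor average is taken outside, the squared norm of \<open>u\<close> enters
  only through its Laplace transform, which is that of the Gamma law with parameter
  \<open>card V\<close>.\<close>

lemma cofactor_laplace_le_gamma:
  fixes W :: "'a set"
  assumes [simp]: "finite W" and l: "l \<notin> W" and k: "k \<notin> insert l W" and t: "0 \<le> t"
  defines "V \<equiv> insert k (insert l W)"
  shows "cofactor_laplace V t \<le> (\<integral>\<^sup>+y. cofactor_laplace W (t * y) \<partial>gamma_law (card V))"
proof -
  have V: "finite V" "V \<noteq> {}"
    by (auto simp: V_def)
  then have "1 \<le> card V"
    by (simp add: Suc_leI card_gt_0_iff)
  have "cofactor_laplace V t \<le>
    (\<integral>\<^sup>+u. cofactor_laplace W (t * (\<Sum>j\<in>V. (cmod (u j))\<^sup>2)) \<partial>gauss_vec V)"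
    unfolding V_def by (rule cofactor_laplace_le_gauss) fact+
  also have "\<dots> = (\<integral>\<^sup>+x. \<integral>\<^sup>+u. exp (- (t * (\<Sum>j\<in>V. (cmod (u j))\<^sup>2)) * cofactor_norm W x)
      \<partial>gauss_vec V \<partial>gauss_vec (edges W))"
    unfolding cofactor_laplace_def by (rule gauss_vec2.Fubini') measurable
  also have "\<dots> = (\<integral>\<^sup>+x. ennreal ((1 / (1 + t * cofactor_norm W x)) ^ card V) \<partial>gauss_vec (edges W))"
  proof (rule nn_integral_cong)
    fix x
    have c: "0 \<le> t * cofactor_norm W x"
      by (intro mult_nonneg_nonneg t cofactor_norm_nonneg)
    have "(\<integral>\<^sup>+u. exp (- (t * (\<Sum>j\<in>V. (cmod (u j))\<^sup>2)) * cofactor_norm W x) \<partial>gauss_vec V) =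
        (\<integral>\<^sup>+u. exp (- (t * cofactor_norm W x) * (\<Sum>j\<in>V. (cmod (u j))\<^sup>2)) \<partial>gauss_vec V)"
      by (simp add: mult_ac)
    also have "\<dots> = ennreal (\<integral>u. exp (- (t * cofactor_norm W x) * (\<Sum>j\<in>V. (cmod (u j))\<^sup>2)) \<partial>gauss_vec V)"
    proof (intro nn_integral_eq_integral gauss_vec.integrable_const_bound[where B = 1])
      have "0 \<le> t * cofactor_norm W x * (\<Sum>j\<in>V. (cmod (u j))\<^sup>2)" for u
        using c by (simp add: sum_nonneg)
      then show "AE u in gauss_vec V. norm (exp (- (t * cofactor_norm W x) * (\<Sum>j\<in>V. (cmod (u j))\<^sup>2))) \<le> 1"
        by simp
    qed auto
    finally show "(\<integral>\<^sup>+u. exp (- (t * (\<Sum>j\<in>V. (cmod (u j))\<^sup>2)) * cofactor_norm W x) \<partial>gauss_vec V) =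
        ennreal ((1 / (1 + t * cofactor_norm W x)) ^ card V)"
      by (simp only: integral_exp_gauss_vec[OF V(1) c])
  qed
  also have "\<dots> = (\<integral>\<^sup>+y. cofactor_laplace W (t * y) \<partial>gamma_law (card V))"
    by (rule nn_integral_cofactor_laplace_gamma[symmetric]) fact+
  finally show ?thesis .
qed

text \<open>An auxiliary complex Gaussian \<open>z\<close> linearises the squared modulus.
  Integrating over \<open>u\<close> first then leaves a Gaussian integral in \<open>z\<close>
  alone.\<close>

lemma integral_exp_linear_gauss_vec:
  assumes [simp]: "finite W" and s: "0 \<le> s"
  shows "(\<integral>u. exp (- s * (cmod (\<Sum>j\<in>W. u j * d j))\<^sup>2) \<partial>gauss_vec W) =
    1 / (1 + s * (\<Sum>j\<in>W. (cmod (d j))\<^sup>2))"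
proof -
  interpret P: pair_prob_space "gauss_vec W" cgauss ..
  define r where "r = 2 * sqrt s"
  have r: "r\<^sup>2 = 4 * s"
    using s by (simp add: r_def power_mult_distrib)
  let ?S = "\<Sum>j\<in>W. (cmod (d j))\<^sup>2"
  let ?h = "\<lambda>u z. iexp (Re ((of_real r * (\<Sum>j\<in>W. u j * d j)) * z))"
  have "complex_of_real (\<integral>u. exp (- s * (cmod (\<Sum>j\<in>W. u j * d j))\<^sup>2) \<partial>gauss_vec W) =
      (\<integral>u. \<integral>z. ?h u z \<partial>cgauss \<partial>gauss_vec W)"
    by (simp only: char_cgauss norm_mult norm_of_real power_mult_distrib power2_abs r exp_of_real
        integral_complex_of_real[symmetric]) simp
  also have "\<dots> = (\<integral>z. \<integral>u. ?h u z \<partial>gauss_vec W \<partial>cgauss)"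
    by (rule P.Fubini_integral[symmetric])
       (rule P.P.integrable_const_bound[where B = 1], simp only: split_beta norm_exp_i_times, simp, measurable)
  also have "\<dots> = (\<integral>z. of_real (exp (- (s * ?S) * (cmod z)\<^sup>2)) \<partial>cgauss)"
  proof (intro Bochner_Integration.integral_cong refl)
    fix z
    have "(of_real r * (\<Sum>j\<in>W. u j * d j)) * z = (\<Sum>j\<in>W. (of_real r * d j * z) * u j)" for u
      by (simp add: sum_distrib_left sum_distrib_right mult_ac)
    then have "(\<integral>u. ?h u z \<partial>gauss_vec W) = of_real (exp (- (\<Sum>j\<in>W. (cmod (of_real r * d j * z))\<^sup>2) / 4))"
      by (simp only: char_gauss_vec[OF assms(1)])
    also have "(\<Sum>j\<in>W. (cmod (of_real r * d j * z))\<^sup>2) = 4 * s * ?S * (cmod z)\<^sup>2"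
      by (simp add: sum_distrib_left sum_distrib_right norm_mult power_mult_distrib r)
    finally show "(\<integral>u. ?h u z \<partial>gauss_vec W) = of_real (exp (- (s * ?S) * (cmod z)\<^sup>2))"
      by simp
  qed
  also have "\<dots> = of_real (1 / (1 + s * ?S))"
    using s by (simp only: integral_complex_of_real, subst integral_exp_cgauss) (auto simp: sum_nonneg)
  finally show ?thesis
    by (simp only: of_real_eq_iff)
qed

text \<open>Given the weights on \<open>W\<close>, the hafnian is a linear form in the Gaussian row
  of \<open>a\<close> with the cofactors as coefficients, so its squared modulus is
  \<open>cofactor_norm W\<close> times an exponential variable, that is, one of law Gamma(1,
  1).\<close>

lemma haf_laplace_eq:
  assumes [simp]: "finite W" and a: "a \<notin> W" and s: "0 \<le> s"
  shows "(\<integral>\<^sup>+x. exp (- s * (cmod (haf (insert a W) x))\<^sup>2) \<partial>gauss_vec (edges (insert a W))) =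
    (\<integral>\<^sup>+y. cofactor_laplace W (s * y) \<partial>gamma_law 1)"
proof -
  let ?F = "\<lambda>x. exp (- s * (cmod (haf (insert a W) x))\<^sup>2)"
  have F: "?F \<in> borel_measurable (gauss_vec (edges (insert a W)))"
    by measurable
  have F1: "norm (?F x) \<le> 1" for x
    using s by simp
  have "(\<integral>\<^sup>+x. ?F x \<partial>gauss_vec (edges (insert a W))) =
      ennreal (\<integral>x. ?F x \<partial>gauss_vec (edges (insert a W)))"
    using F F1 by (intro nn_integral_eq_integral gauss_vec.integrable_const_bound[where B = 1]) auto
  also have "(\<integral>x. ?F x \<partial>gauss_vec (edges (insert a W))) =
      (\<integral>x. \<integral>u. ?F (star_ext a W x u) \<partial>gauss_vec W \<partial>gauss_vec (edges W))"
    by (rule integral_star_ext[OF assms(1) a F F1])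
  also have "\<dots> = (\<integral>x. 1 / (1 + s * cofactor_norm W x) \<partial>gauss_vec (edges W))"
    unfolding haf_insert_star_ext[OF assms(1) a order_refl] integral_exp_linear_gauss_vec[OF assms(1) s]
    by (simp only: cofactor_norm_def)
  also have "ennreal \<dots> = (\<integral>\<^sup>+x. ennreal ((1 / (1 + s * cofactor_norm W x)) ^ 1) \<partial>gauss_vec (edges W))"
  proof (subst nn_integral_eq_integral)
    show "integrable (gauss_vec (edges W)) (\<lambda>x. (1 / (1 + s * cofactor_norm W x)) ^ 1)"
      using s cofactor_norm_nonneg[of W]
      by (intro gauss_vec.integrable_const_bound[where B = 1]) (auto simp: divide_le_eq add_nonneg_nonneg)
  qed (use s cofactor_norm_nonneg[of W] in auto)
  also have "\<dots> = (\<integral>\<^sup>+y. cofactor_laplace W (s * y) \<partial>gamma_law 1)"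
    by (rule nn_integral_cofactor_laplace_gamma[symmetric]) (use s in auto)
  finally show ?thesis .
qed

section \<open>Laws of the matrix and of the gamma products\<close>

lemma (in prob_space) distr_standard_complex_gaussian:
  assumes "standard_complex_gaussian M Z"
  shows "Z \<in> borel_measurable M" "distr M borel Z = cgauss"
proof -
  let ?X = "\<lambda>\<omega>. Re (Z \<omega>)" and ?Y = "\<lambda>\<omega>. Im (Z \<omega>)"
  have ind: "indep_var borel ?X borel ?Y"
    and X: "distributed M lborel ?X (normal_density 0 (sqrt (1 / 2)))"
    and Y: "distributed M lborel ?Y (normal_density 0 (sqrt (1 / 2)))"
    using assms by (auto simp: standard_complex_gaussian_def)
  have [measurable]: "?X \<in> borel_measurable M" "?Y \<in> borel_measurable M"
    using distributed_measurable[OF X] distributed_measurable[OF Y] by auto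
  have "(\<lambda>\<omega>. Complex (?X \<omega>) (?Y \<omega>)) \<in> borel_measurable M"
    by measurable
  then show "Z \<in> borel_measurable M"
    by simp
  have "distr M borel ?X = real_gauss" "distr M borel ?Y = real_gauss"
    using distributed_distr_eq_density[OF X] distributed_distr_eq_density[OF Y]
    by (auto simp: real_gauss_def cong: distr_cong)
  with ind have joint: "distr M (borel \<Otimes>\<^sub>M borel) (\<lambda>\<omega>. (?X \<omega>, ?Y \<omega>)) = real_gauss \<Otimes>\<^sub>M real_gauss"
    unfolding indep_var_distribution_eq by simp
  show "distr M borel Z = cgauss"
    unfolding cgauss_def joint[symmetric] by (subst distr_distr) (auto simp: comp_def)
qed

text \<open>The independent entries are indexed by pairs i < j; the injection of an edge
  \<open>e\<close> to \<open>(Min e, Max e)\<close> reindexes them by edges.\<close>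

lemma distr_gaussian_symmetric_matrix:
  assumes G: "gaussian_symmetric_matrix N m G"
  shows "(\<lambda>\<omega>. \<lambda>e\<in>edges {1..m}. G \<omega> (Min e) (Max e)) \<in> measurable N (gauss_vec (edges {1..m}))"
    and "distr N (gauss_vec (edges {1..m})) (\<lambda>\<omega>. \<lambda>e\<in>edges {1..m}. G \<omega> (Min e) (Max e)) =
      gauss_vec (edges {1..m})"
proof -
  interpret N: prob_space N
    using G by (simp add: gaussian_symmetric_matrix_def)
  let ?P = "{(i, j). 1 \<le> i \<and> i < j \<and> j \<le> m}" and ?E = "edges {1..m}"
  let ?X = "\<lambda>(i, j) \<omega>. G \<omega> i j" and ?h = "\<lambda>e::nat set. (Min e, Max e)"
  let ?T = "\<lambda>\<omega>. \<lambda>e\<in>?E. G \<omega> (Min e) (Max e)"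
  have ind: "N.indep_vars (\<lambda>_. borel) ?X ?P"
    and std: "\<And>p. p \<in> ?P \<Longrightarrow> standard_complex_gaussian N (?X p)"
    using G by (auto simp: gaussian_symmetric_matrix_def)
  have rv: "?X p \<in> borel_measurable N" and dist: "distr N borel (?X p) = cgauss" if "p \<in> ?P" for p
    using N.distr_standard_complex_gaussian[OF std[OF that]] by auto
  have h: "?h e \<in> ?P" "{Min e, Max e} = e" if e: "e \<in> ?E" for e
  proof -
    from e obtain i j where "e = {i, j}" "i \<noteq> j" "i \<in> {1..m}" "j \<in> {1..m}"
      unfolding edges_def card_2_iff by auto
    then show "?h e \<in> ?P" "{Min e, Max e} = e"
      by (cases "i \<le> j"; auto simp: min_def max_def)+
  qed
  have inj: "inj_on ?h ?E"
    using h(2) by (intro inj_onI) (metis prod.inject)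
  have "(\<lambda>\<omega>. \<lambda>e\<in>?E. ?X (?h e) \<omega>) \<in> measurable N (gauss_vec ?E)"
    using rv[OF h(1)] by (intro measurable_restrict) (simp cong: measurable_cong_sets)
  then show T: "?T \<in> measurable N (gauss_vec ?E)"
    by simp
  show "distr N (gauss_vec ?E) ?T = gauss_vec ?E"
  proof (cases "?P = {}")
    \<comment> \<open>This covers the 1 x 1 matrix behind \<open>C_1\<close>. The product
      characterisation of independence used below asks for a nonempty index set, so the law is
      checked directly.\<close>
    case True
    with h(1) have E: "?E = {}"
      by blast
    interpret product_prob_space "\<lambda>_. cgauss" ?E ..
    show ?thesis
    proof (rule PiM_eqI)
      fix A
      have "?T -` Pi\<^sub>E ?E A \<inter> space N = space N"
        using E by auto
      moreover have "Pi\<^sub>E ?E A \<in> sets (gauss_vec ?E)"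
        using E by (intro sets_PiM_I_finite) auto
      moreover have "(\<Prod>e\<in>?E. emeasure cgauss (A e)) = 1"
        by (simp only: E prod.empty)
      ultimately show "emeasure (distr N (gauss_vec ?E) ?T) (Pi\<^sub>E ?E A) = (\<Prod>e\<in>?E. emeasure cgauss (A e))"
        by (simp only: emeasure_distr[OF T] N.emeasure_space_1)
    qed auto
  next
    case False
    have "distr N (PiM ?P (\<lambda>_. borel)) (\<lambda>\<omega>. \<lambda>p\<in>?P. ?X p \<omega>) = PiM ?P (\<lambda>p. distr N borel (?X p))"
      using N.indep_vars_iff_distr_eq_PiM'[OF False rv] ind by simp
    also have "\<dots> = gauss_vec ?P"
      using dist by (intro PiM_cong) auto
    finally have P: "distr N (gauss_vec ?P) (\<lambda>\<omega>. \<lambda>p\<in>?P. ?X p \<omega>) = gauss_vec ?P"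
      by (simp cong: distr_cong sets_PiM_cong)
    have TP: "(\<lambda>\<omega>. \<lambda>p\<in>?P. ?X p \<omega>) \<in> measurable N (gauss_vec ?P)"
      using rv by (intro measurable_restrict) (simp cong: measurable_cong_sets)
    have "gauss_vec ?E = distr (gauss_vec ?P) (gauss_vec ?E) (\<lambda>x. \<lambda>e\<in>?E. x (?h e))"
      using distr_PiM_reindex[of ?P "\<lambda>_. cgauss" ?h ?E] inj h(1) cgauss.prob_space_axioms by auto
    also have "\<dots> = distr N (gauss_vec ?E) ((\<lambda>x. \<lambda>e\<in>?E. x (?h e)) \<circ> (\<lambda>\<omega>. \<lambda>p\<in>?P. ?X p \<omega>))"
      using h(1) by (subst P[symmetric], intro distr_distr TP measurable_restrict) auto
    also have "(\<lambda>x. \<lambda>e\<in>?E. x (?h e)) \<circ> (\<lambda>\<omega>. \<lambda>p\<in>?P. ?X p \<omega>) = ?T"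
      using h(1) by (auto simp: fun_eq_iff)
    finally show ?thesis
      by (rule sym)
  qed
qed

lemma hafnian_eq_haf:
  assumes "V \<subseteq> W"
  shows "hafnian V A = haf V (\<lambda>e\<in>edges W. A (Min e) (Max e))"
proof -
  have "hafnian V A = haf V (\<lambda>e. A (Min e) (Max e))"
    by (simp add: hafnian_def haf_def)
  also have "\<dots> = haf V (\<lambda>e\<in>edges W. A (Min e) (Max e))"
    using edges_mono[OF assms] by (intro haf_cong) auto
  finally show ?thesis .
qed

text \<open>Nonnegativity of \<open>U\<close> makes the larger nonnegative integral finite, so the
  inequality survives the passage to real-valued integrals.\<close>

lemma laplace_leI:
  assumes "prob_space M"
    and [measurable]: "U \<in> borel_measurable M" "V \<in> borel_measurable N"
    and U: "AE \<omega> in M. 0 \<le> U \<omega>"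
    and le: "\<And>s. 0 \<le> s \<Longrightarrow> (\<integral>\<^sup>+\<omega>. exp (- s * V \<omega>) \<partial>N) \<le> (\<integral>\<^sup>+\<omega>. exp (- s * U \<omega>) \<partial>M)"
  shows "laplace_le M U N V"
  unfolding laplace_le_def
proof (intro allI impI)
  fix s :: real assume s: "0 \<le> s"
  interpret prob_space M by fact
  have "(\<integral>\<^sup>+\<omega>. exp (- s * U \<omega>) \<partial>M) \<le> (\<integral>\<^sup>+\<omega>. 1 \<partial>M)"
    using U s by (intro nn_integral_mono_AE) (auto elim!: eventually_mono)
  also have "\<dots> < \<infinity>"
    by (simp add: emeasure_space_1)
  finally show "(\<integral>\<omega>. exp (- s * V \<omega>) \<partial>N) \<le> (\<integral>\<omega>. exp (- s * U \<omega>) \<partial>M)"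
    using le[OF s] by (subst (1 2) integral_eq_nn_integral) (auto intro!: enn2real_mono)
qed

section \<open>Products of independent gamma variables\<close>

locale gamma_family = prob_space M for M :: "'a measure" +
  fixes \<gamma> :: "nat \<Rightarrow> 'a \<Rightarrow> real"
  assumes indep: "indep_vars (\<lambda>_. borel) \<gamma> {r. odd r}"
    and gamma: "odd r \<Longrightarrow> distributed M lborel (\<gamma> r) (gamma_density (real r))"
begin

lemma measurable_gamma: "odd r \<Longrightarrow> \<gamma> r \<in> borel_measurable M"
  using distributed_measurable[OF gamma] by simp

lemma distr_gamma: "odd r \<Longrightarrow> distr M borel (\<gamma> r) = gamma_law r"
  using distributed_distr_eq_density[OF gamma] by (simp add: gamma_law_def cong: distr_cong)

lemma AE_gamma_pos: "odd r \<Longrightarrow> AE \<omega> in M. 0 < \<gamma> r \<omega>"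
  using AE_gamma_law_pos[of r] measurable_gamma[of r]
  by (subst (asm) distr_gamma[symmetric]) (auto simp: AE_distr_iff)

lemma AE_prod_nonneg:
  assumes "finite I" "\<And>r. r \<in> I \<Longrightarrow> odd r"
  shows "AE \<omega> in M. 0 \<le> (\<Prod>r\<in>I. \<gamma> r \<omega>)"
proof -
  have "AE \<omega> in M. \<forall>r\<in>I. 0 < \<gamma> r \<omega>"
    using assms AE_gamma_pos by (intro AE_finite_allI) auto
  then show ?thesis
    by (rule eventually_mono) (auto intro: prod_nonneg less_imp_le)
qed

text \<open>By independence the joint law of \<open>\<gamma> i\<close> and the product over
  \<open>I\<close> is a product measure, so the mixture over \<open>gamma_law i\<close> is an
  expectation over \<open>M\<close>.\<close>

lemma nn_integral_gamma_prod:
  assumes "finite I" "\<And>r. r \<in> I \<Longrightarrow> odd r" "odd i" "i \<notin> I"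
  shows "(\<integral>\<^sup>+y. \<integral>\<^sup>+\<omega>. exp (- (t * y) * (\<Prod>r\<in>I. \<gamma> r \<omega>)) \<partial>M \<partial>gamma_law i) =
    (\<integral>\<^sup>+\<omega>. exp (- t * (\<gamma> i \<omega> * (\<Prod>r\<in>I. \<gamma> r \<omega>))) \<partial>M)"
proof -
  let ?\<Pi> = "\<lambda>\<omega>. \<Prod>r\<in>I. \<gamma> r \<omega>"
  note [measurable] = measurable_gamma[OF assms(3)] borel_measurable_prod[OF measurable_gamma[OF assms(2)], of I "\<lambda>r. r"]
  interpret D: prob_space "distr M borel ?\<Pi>"
    by (rule prob_space_distr) measurable
  have "indep_vars (\<lambda>_. borel) \<gamma> (insert i I)"
    using assms by (intro indep_vars_subset[OF indep]) auto
  from indep_vars_prod[OF assms(1,4) this]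
  have "indep_var borel (\<gamma> i) borel ?\<Pi>" .
  then have joint: "gamma_law i \<Otimes>\<^sub>M distr M borel ?\<Pi> = distr M (borel \<Otimes>\<^sub>M borel) (\<lambda>\<omega>. (\<gamma> i \<omega>, ?\<Pi> \<omega>))"
    unfolding indep_var_distribution_eq distr_gamma[OF assms(3)] by simp
  have "(\<integral>\<^sup>+y. \<integral>\<^sup>+\<omega>. exp (- (t * y) * ?\<Pi> \<omega>) \<partial>M \<partial>gamma_law i) =
      (\<integral>\<^sup>+y. \<integral>\<^sup>+p. exp (- (t * y) * p) \<partial>distr M borel ?\<Pi> \<partial>gamma_law i)"
    by (intro nn_integral_cong) (subst nn_integral_distr; measurable)
  also have "\<dots> = (\<integral>\<^sup>+z. exp (- (t * fst z) * snd z) \<partial>(gamma_law i \<Otimes>\<^sub>M distr M borel ?\<Pi>))"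
    by (subst D.nn_integral_fst[symmetric]) auto
  also have "\<dots> = (\<integral>\<^sup>+\<omega>. exp (- t * (\<gamma> i \<omega> * ?\<Pi> \<omega>)) \<partial>M)"
    unfolding joint by (subst nn_integral_distr) (auto simp: mult_ac)
  finally show ?thesis .
qed

lemma prod_gamma_reindex:
  assumes "1 \<le> a"
  shows "(\<Prod>j = a..n. \<gamma> (2 * j - 1) \<omega>) = (\<Prod>r\<in>(\<lambda>j. 2 * j - 1) ` {a..n}. \<gamma> r \<omega>)"
  using assms by (subst prod.reindex) (auto intro!: inj_onI)

lemma prod_gamma:
  assumes "1 \<le> a"
  shows measurable_prod_gamma: "(\<lambda>\<omega>. \<Prod>j = a..n. \<gamma> (2 * j - 1) \<omega>) \<in> borel_measurable M"
    and AE_prod_gamma: "AE \<omega> in M. 0 \<le> (\<Prod>j = a..n. \<gamma> (2 * j - 1) \<omega>)"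
proof -
  \<comment> \<open>The bound \<open>1 \<le> a\<close> matters here: for \<open>j = 0\<close>
    truncated subtraction would give the even index 0.\<close>
  have odd: "odd (2 * j - 1)" if "j \<in> {a..n}" for j
    using that assms by auto
  show "(\<lambda>\<omega>. \<Prod>j = a..n. \<gamma> (2 * j - 1) \<omega>) \<in> borel_measurable M"
    using measurable_gamma[OF odd] by (rule borel_measurable_prod)
  show "AE \<omega> in M. 0 \<le> (\<Prod>j = a..n. \<gamma> (2 * j - 1) \<omega>)"
    unfolding prod_gamma_reindex[OF assms]
    by (rule AE_prod_nonneg) (simp, elim imageE, simp only: odd not_False_eq_True)
qed

lemma gamma_mixture_le:
  assumes odd: "odd i" and new: "i \<notin> (\<lambda>j. 2 * j - 1) ` {2..n}" and t: "0 \<le> t"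
    and le: "\<And>s. 0 \<le> s \<Longrightarrow> cofactor_laplace W s \<le> (\<integral>\<^sup>+\<omega>. exp (- s * (\<Prod>j = 2..n. \<gamma> (2 * j - 1) \<omega>)) \<partial>M)"
  shows "(\<integral>\<^sup>+y. cofactor_laplace W (t * y) \<partial>gamma_law i) \<le>
    (\<integral>\<^sup>+\<omega>. exp (- t * (\<gamma> i \<omega> * (\<Prod>j = 2..n. \<gamma> (2 * j - 1) \<omega>))) \<partial>M)"
proof -
  have "(\<integral>\<^sup>+y. cofactor_laplace W (t * y) \<partial>gamma_law i) \<le>
      (\<integral>\<^sup>+y. \<integral>\<^sup>+\<omega>. exp (- (t * y) * (\<Prod>j = 2..n. \<gamma> (2 * j - 1) \<omega>)) \<partial>M \<partial>gamma_law i)"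
    \<comment> \<open>Almost every \<open>y\<close> is positive, so the hypothesis applies at the
      argument \<open>t * y\<close>.\<close>
    using AE_gamma_law_pos[of i] t
    by (intro nn_integral_mono_AE) (auto elim!: eventually_mono intro!: le[of "t * _", simplified])
  also have "\<dots> = (\<integral>\<^sup>+\<omega>. exp (- t * (\<gamma> i \<omega> * (\<Prod>j = 2..n. \<gamma> (2 * j - 1) \<omega>))) \<partial>M)"
    using new odd
    by (simp only: prod_gamma_reindex[OF one_le_numeral]) (intro nn_integral_gamma_prod; auto)
  finally show ?thesis .
qed

text \<open>Each induction step removes two vertices and multiplies the comparison variable by the
  gamma variable whose parameter is the number of vertices.\<close>

lemma cofactor_laplace_le_prod_gamma:
  assumes "1 \<le> n" "finite W" "card W = 2 * n - 1" "0 \<le> t"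
  shows "cofactor_laplace W t \<le> (\<integral>\<^sup>+\<omega>. exp (- t * (\<Prod>j = 2..n. \<gamma> (2 * j - 1) \<omega>)) \<partial>M)"
  using assms
proof (induction n arbitrary: W t rule: dec_induct)
  case base
  then obtain a where "W = {a}"
    by (auto simp: card_1_singleton_iff)
  \<comment> \<open>With one vertex the only cofactor is the empty hafnian 1, and the product is
    empty as well.\<close>
  then show ?case
    by (simp add: cofactor_laplace_def cofactor_norm_def emeasure_space_1 gauss_vec.emeasure_space_1)
next
  case (step n)
  have "card W = Suc (Suc (2 * n - 1))"
    using step by simp
  then obtain k l V where W: "W = insert k (insert l V)" and k: "k \<notin> insert l V" and l: "l \<notin> V"
    and V: "card V = 2 * n - 1"
    unfolding card_Suc_eq by blast
  have fin: "finite V"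
    using step W by simp
  have card: "card W = 2 * Suc n - 1"
    using step by simp
  have "cofactor_laplace W t \<le> (\<integral>\<^sup>+y. cofactor_laplace V (t * y) \<partial>gamma_law (2 * Suc n - 1))"
    using cofactor_laplace_le_gamma[OF fin l k \<open>0 \<le> t\<close>] unfolding W[symmetric] card .
  also have "\<dots> \<le> (\<integral>\<^sup>+\<omega>. exp (- t * (\<gamma> (2 * Suc n - 1) \<omega> * (\<Prod>j = 2..n. \<gamma> (2 * j - 1) \<omega>))) \<partial>M)"
    using step.IH[OF fin V] step.prems by (intro gamma_mixture_le) auto
  also have "\<dots> = (\<integral>\<^sup>+\<omega>. exp (- t * (\<Prod>j = 2..Suc n. \<gamma> (2 * j - 1) \<omega>)) \<partial>M)"
    using step.hyps by (simp add: mult.commute)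
  finally show ?case .
qed

end

theorem theorem1p2:
  fixes M :: "'a measure" and \<gamma> :: "nat \<Rightarrow> 'a \<Rightarrow> real"
    and N :: "'b measure" and B :: "'b \<Rightarrow> nat \<Rightarrow> nat \<Rightarrow> complex"
    and L :: "'c measure" and G :: "'c \<Rightarrow> nat \<Rightarrow> nat \<Rightarrow> complex"
    and n :: nat
  assumes "prob_space M"
    and "prob_space.indep_vars M (\<lambda>_. borel) \<gamma> {r. odd r}"
    and "\<And>r. odd r \<Longrightarrow> distributed M lborel (\<gamma> r) (gamma_density (real r))"
    and "n \<ge> 1"
  shows "(gaussian_symmetric_matrix N (2 * n - 1) B \<longrightarrow>
            laplace_le M (\<lambda>\<omega>. \<Prod>j = 2..n. \<gamma> (2 * j - 1) \<omega>)
              N (\<lambda>\<omega>. (L2_set (\<lambda>j. cmod (hafnian_cofactor {1..2 * n - 1} (B \<omega>) j)) {1..2 * n - 1})\<^sup>2))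
       \<and> (gaussian_symmetric_matrix L (2 * n) G \<longrightarrow>
            laplace_le M (\<lambda>\<omega>. \<Prod>j = 1..n. \<gamma> (2 * j - 1) \<omega>)
              L (\<lambda>\<omega>. (cmod (hafnian {1..2 * n} (G \<omega>)))\<^sup>2))"
proof (intro conjI impI)
  interpret gamma_family M \<gamma>
    using assms(1-3) by (simp add: gamma_family_def gamma_family_axioms_def)
  note laplace_le = cofactor_laplace_le_prod_gamma[OF assms(4), of "{1..2 * n - 1}"]
  {
    assume B: "gaussian_symmetric_matrix N (2 * n - 1) B"
    let ?W = "{1..2 * n - 1}"
    let ?T = "\<lambda>\<omega>. \<lambda>e\<in>edges ?W. B \<omega> (Min e) (Max e)"
    note T [measurable] = distr_gaussian_symmetric_matrix(1)[OF B]
    have eq: "(L2_set (\<lambda>j. cmod (hafnian_cofactor ?W (B \<omega>) j)) ?W)\<^sup>2 = cofactor_norm ?W (?T \<omega>)" for \<omega>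
      unfolding L2_set_def cofactor_norm_def hafnian_cofactor_def hafnian_eq_haf[OF Diff_subset]
      by (intro real_sqrt_pow2 sum_nonneg) simp
    show "laplace_le M (\<lambda>\<omega>. \<Prod>j = 2..n. \<gamma> (2 * j - 1) \<omega>)
      N (\<lambda>\<omega>. (L2_set (\<lambda>j. cmod (hafnian_cofactor ?W (B \<omega>) j)) ?W)\<^sup>2)"
      unfolding eq
    proof (rule laplace_leI)
      show "(\<lambda>\<omega>. cofactor_norm ?W (?T \<omega>)) \<in> borel_measurable N"
        by (rule measurable_compose[OF T measurable_cofactor_norm])
      fix s :: real assume s: "0 \<le> s"
      have "(\<integral>\<^sup>+\<omega>. exp (- s * cofactor_norm ?W (?T \<omega>)) \<partial>N) =
          (\<integral>\<^sup>+x. exp (- s * cofactor_norm ?W x) \<partial>distr N (gauss_vec (edges ?W)) ?T)"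
        by (rule nn_integral_distr[OF T, symmetric]) measurable
      also have "\<dots> = cofactor_laplace ?W s"
        by (simp only: distr_gaussian_symmetric_matrix(2)[OF B] cofactor_laplace_def)
      also have "\<dots> \<le> (\<integral>\<^sup>+\<omega>. exp (- s * (\<Prod>j = 2..n. \<gamma> (2 * j - 1) \<omega>)) \<partial>M)"
        using s by (intro laplace_le) auto
      finally show "(\<integral>\<^sup>+\<omega>. exp (- s * cofactor_norm ?W (?T \<omega>)) \<partial>N) \<le>
        (\<integral>\<^sup>+\<omega>. exp (- s * (\<Prod>j = 2..n. \<gamma> (2 * j - 1) \<omega>)) \<partial>M)" .
    qed (use measurable_prod_gamma[of 2] AE_prod_gamma[of 2] prob_space_axioms in auto)
  }
  {
    assume G: "gaussian_symmetric_matrix L (2 * n) G"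
    let ?V = "{1..2 * n}" and ?W = "{1..2 * n - 1}"
    let ?T = "\<lambda>\<omega>. \<lambda>e\<in>edges ?V. G \<omega> (Min e) (Max e)"
    note T [measurable] = distr_gaussian_symmetric_matrix(1)[OF G]
    have haf [measurable]: "haf ?V \<in> borel_measurable (gauss_vec (edges ?V))"
      by (rule measurable_haf) simp
    have V: "?V = insert (2 * n) ?W"
      using assms(4) by auto
    show "laplace_le M (\<lambda>\<omega>. \<Prod>j = 1..n. \<gamma> (2 * j - 1) \<omega>) L (\<lambda>\<omega>. (cmod (hafnian ?V (G \<omega>)))\<^sup>2)"
      unfolding hafnian_eq_haf[OF order_refl]
    proof (rule laplace_leI)
      show "(\<lambda>\<omega>. (cmod (haf ?V (?T \<omega>)))\<^sup>2) \<in> borel_measurable L"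
        using measurable_compose[OF T haf] by measurable
      fix s :: real assume s: "0 \<le> s"
      have "(\<integral>\<^sup>+\<omega>. exp (- s * (cmod (haf ?V (?T \<omega>)))\<^sup>2) \<partial>L) =
          (\<integral>\<^sup>+x. exp (- s * (cmod (haf ?V x))\<^sup>2) \<partial>distr L (gauss_vec (edges ?V)) ?T)"
        by (rule nn_integral_distr[OF T, symmetric]) measurable
      also have "\<dots> = (\<integral>\<^sup>+x. exp (- s * (cmod (haf ?V x))\<^sup>2) \<partial>gauss_vec (edges ?V))"
        by (simp only: distr_gaussian_symmetric_matrix(2)[OF G])
      also have "\<dots> = (\<integral>\<^sup>+y. cofactor_laplace ?W (s * y) \<partial>gamma_law 1)"
        \<comment> \<open>Expanding along the last vertex supplies the exponential factor that
          becomes \<open>\<gamma> 1\<close>.\<close>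
        unfolding V using assms(4) s by (intro haf_laplace_eq) auto
      also have "\<dots> \<le> (\<integral>\<^sup>+\<omega>. exp (- s * (\<gamma> 1 \<omega> * (\<Prod>j = 2..n. \<gamma> (2 * j - 1) \<omega>))) \<partial>M)"
        using s by (intro gamma_mixture_le laplace_le) auto
      also have "\<dots> = (\<integral>\<^sup>+\<omega>. exp (- s * (\<Prod>j = 1..n. \<gamma> (2 * j - 1) \<omega>)) \<partial>M)"
        using assms(4) by (simp add: prod.atLeast_Suc_atMost numeral_2_eq_2)
      finally show "(\<integral>\<^sup>+\<omega>. exp (- s * (cmod (haf ?V (?T \<omega>)))\<^sup>2) \<partial>L) \<le>
        (\<integral>\<^sup>+\<omega>. exp (- s * (\<Prod>j = 1..n. \<gamma> (2 * j - 1) \<omega>)) \<partial>M)" .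
    qed (use measurable_prod_gamma[of 1] AE_prod_gamma[of 1] prob_space_axioms in auto)
  }
qed

end
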